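(* Let $M$ be an $m$-dimensional proper biharmonic submanifold with parallel mean curvature vector field $H$ (i.e. $\nabla^\perp H=0$) in the unit Euclidean sphere $\mathbb{S}^n$. Let $p$ be an arbitrary point of $M$ and let $\{e_i\}_{i=1}^m$ be an orthonormal basis of $T_pM$ consisting of eigenvectors of $A_H$. Denote by $\{a_i\}_{i=1}^m$ the corresponding eigenvalues of $A_H$ at $p$. Then, at $p$, (i) $\displaystyle m|H|^2=\sum_{i=1}^m a_i=\sum_{i=1}^m (a_i)^2$; (ii) $\displaystyle (2m-1)m|H|^2=\frac12\sum_{i,j=1}^m (a_i+a_j)\big(K_{ij}+|B(e_i,e_j)|^2\big)$; (iii) $\displaystyle (m-1+m|H|^2)\,m|H|^2=\sum_{i,j=1}^m a_ia_j\big(K_{ij}+|B(e_i,e_j)|^2\big)$, where $K_{ij}$ denotes the sectional curvature of the $2$-plane tangent to $M$ generated by $e_i$ and $e_j$ for $i\neq j$, and $K_{ii}=0$.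
   Context: For a smooth map $\phi:(M,g)\to(N,h)$ between Riemannian manifolds, the tension field is $\tau(\phi)=\operatorname{trace}\nabla d\phi$; $\phi$ is harmonic if $\tau(\phi)=0$, and biharmonic if its bitension field vanishes: $$\tau_2(\phi)=-\Delta\tau(\phi)-\operatorname{trace}R^N(d\phi(\cdot),\tau(\phi))d\phi(\cdot)=0,$$ where $\Delta=-\operatorname{trace}\nabla^2$ is the rough Laplacian on sections of $\phi^{-1}TN$ and $R^N(X,Y)=[\nabla_X,\nabla_Y]-\nabla_{[X,Y]}$. A submanifold $M$ of $N$ is proper biharmonic if its inclusion map (with the induced metric) is biharmonic but not harmonic (equivalently, biharmonic and not minimal). For a submanifold $M^m$ of $\mathbb{S}^n$: $B$ is the second fundamental form, $H=\frac1m\operatorname{trace}B$ the mean curvature vector field, $\nabla^\perp$ the normal connection, and $A$ the Weingarten operator, $\langle A_\xi X,Y\rangle=\langle B(X,Y),\xi\rangle$ for normal $\xi$. *)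

theory Defs
  imports "HOL-Analysis.Analysis"
begin

section \<open>Smooth maps between Euclidean spaces\<close>

primrec Ck_on :: "nat \<Rightarrow> 'a::euclidean_space set \<Rightarrow> ('a \<Rightarrow> 'b::real_normed_vector) \<Rightarrow> bool" where
  "Ck_on 0 U f \<longleftrightarrow> continuous_on U f"
| "Ck_on (Suc k) U f \<longleftrightarrow>
     (\<forall>u\<in>U. f differentiable (at u)) \<and> (\<forall>v. Ck_on k U (\<lambda>u. frechet_derivative f (at u) v))"

text \<open>Only used for open \<open>U\<close>.\<close>
definition smooth_on :: "'a::euclidean_space set \<Rightarrow> ('a \<Rightarrow> 'b::real_normed_vector) \<Rightarrow> bool" where
  "smooth_on U f \<longleftrightarrow> (\<forall>k. Ck_on k U f)"

definition pd :: "'m::finite \<Rightarrow> (real ^ 'm \<Rightarrow> 'b::real_normed_vector) \<Rightarrow> real ^ 'm \<Rightarrow> 'b" where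
  "pd i f u = frechet_derivative f (at u) (axis i 1)"


section \<open>Immersed submanifolds of the unit sphere\<close>

text \<open>
  An atlas is a set of pairs \<open>(U, x)\<close> with \<open>x\<close> a local parametrization, i.e. the inverse of a
  coordinate map; the dimension is \<open>CARD('m)\<close>, hence at least one.
\<close>
definition smooth_manifold ::
  "'p topology \<Rightarrow> ((real ^ 'm::finite) set \<times> (real ^ 'm \<Rightarrow> 'p)) set \<Rightarrow> bool" where
  "smooth_manifold M \<A> \<longleftrightarrow>
     Hausdorff_space M \<and> second_countable M \<and>
     (\<forall>(U, x)\<in>\<A>. open U \<and> openin M (x ` U) \<and>
        homeomorphic_map (top_of_set U) (subtopology M (x ` U)) x) \<and>
     (\<Union>(U, x)\<in>\<A>. x ` U) = topspace M \<and>
     (\<forall>(U, x)\<in>\<A>. \<forall>(V, y)\<in>\<A>. smooth_on (U \<inter> x -` (y ` V)) (inv_into V y \<circ> x))"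

text \<open>
  A submanifold of the sphere is an abstract manifold with an immersion into the sphere; an
  embedded submanifold is the case in which \<open>\<phi>\<close> is the identity of a subset of the sphere.
\<close>
definition sphere_submanifold ::
  "'p topology \<Rightarrow> ((real ^ 'm::finite) set \<times> (real ^ 'm \<Rightarrow> 'p)) set
     \<Rightarrow> ('p \<Rightarrow> 'a::euclidean_space) \<Rightarrow> bool" where
  "sphere_submanifold M \<A> \<phi> \<longleftrightarrow>
     smooth_manifold M \<A> \<and> \<phi> ` topspace M \<subseteq> sphere 0 1 \<and>
     (\<forall>(U, x)\<in>\<A>. smooth_on U (\<phi> \<circ> x) \<and>
        (\<forall>u\<in>U. inj (frechet_derivative (\<phi> \<circ> x) (at u))))"


section \<open>Connections and curvature\<close>

text \<open>
  Vector fields on (an open subset of) a Euclidean space are functions of a point;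
  \<open>nabla X Y\<close> stands for the covariant derivative of \<open>Y\<close> along \<open>X\<close>.
\<close>
definition lie_bracket ::
  "('b::real_normed_vector \<Rightarrow> 'b) \<Rightarrow> ('b \<Rightarrow> 'b) \<Rightarrow> 'b \<Rightarrow> 'b" where
  "lie_bracket X Y p =
     frechet_derivative Y (at p) (X p) - frechet_derivative X (at p) (Y p)"

definition curvature ::
  "(('b::real_normed_vector \<Rightarrow> 'b) \<Rightarrow> ('b \<Rightarrow> 'b) \<Rightarrow> 'b \<Rightarrow> 'b)
     \<Rightarrow> ('b \<Rightarrow> 'b) \<Rightarrow> ('b \<Rightarrow> 'b) \<Rightarrow> ('b \<Rightarrow> 'b) \<Rightarrow> 'b \<Rightarrow> 'b" where
  "curvature nabla X Y Z p =
     nabla X (nabla Y Z) p - nabla Y (nabla X Z) p - nabla (lie_bracket X Y) Z p"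

subsection \<open>Riemannian metrics in coordinates\<close>

definition metric_prod :: "real ^ 'm ^ 'm \<Rightarrow> real ^ 'm \<Rightarrow> real ^ 'm \<Rightarrow> real" where
  "metric_prod G v w = v \<bullet> (G *v w)"

definition metric_trace ::
  "real ^ 'm ^ 'm \<Rightarrow> ('m \<Rightarrow> 'm \<Rightarrow> 'b::real_vector) \<Rightarrow> 'b" where
  "metric_trace G T = (\<Sum>i\<in>UNIV. \<Sum>j\<in>UNIV. matrix_inv G $ i $ j *\<^sub>R T i j)"

text \<open>\<open>christoffel g k i j\<close> has upper index \<open>k\<close> and lower indices \<open>i\<close>, \<open>j\<close>.\<close>
definition christoffel ::
  "(real ^ 'm \<Rightarrow> real ^ 'm ^ 'm) \<Rightarrow> 'm::finite \<Rightarrow> 'm \<Rightarrow> 'm \<Rightarrow> real ^ 'm \<Rightarrow> real" where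
  "christoffel g k i j u =
     (1/2) * (\<Sum>l\<in>UNIV. matrix_inv (g u) $ k $ l *
        (pd i (\<lambda>w. g w $ j $ l) u + pd j (\<lambda>w. g w $ i $ l) u - pd l (\<lambda>w. g w $ i $ j) u))"

definition levi_civita ::
  "(real ^ 'm \<Rightarrow> real ^ 'm ^ 'm) \<Rightarrow> (real ^ 'm::finite \<Rightarrow> real ^ 'm)
     \<Rightarrow> (real ^ 'm \<Rightarrow> real ^ 'm) \<Rightarrow> real ^ 'm \<Rightarrow> real ^ 'm" where
  "levi_civita g X Y u =
     frechet_derivative Y (at u) (X u) +
     (\<chi> k. \<Sum>i\<in>UNIV. \<Sum>j\<in>UNIV. christoffel g k i j u * X u $ i * Y u $ j)"

text \<open>Tangent vectors are extended to vector fields with constant coefficients.\<close>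
definition sectional_curvature ::
  "(real ^ 'm \<Rightarrow> real ^ 'm ^ 'm) \<Rightarrow> real ^ 'm::finite \<Rightarrow> real ^ 'm \<Rightarrow> real ^ 'm \<Rightarrow> real" where
  "sectional_curvature g u v w =
     metric_prod (g u) (curvature (levi_civita g) (\<lambda>_. v) (\<lambda>_. w) (\<lambda>_. w) u) v /
     (metric_prod (g u) v v * metric_prod (g u) w w - (metric_prod (g u) v w)\<^sup>2)"

subsection \<open>The round sphere\<close>

text \<open>For \<open>y\<close> on the unit sphere, the orthogonal projection onto the tangent space at \<open>y\<close>.\<close>
definition sphere_proj :: "'a::euclidean_space \<Rightarrow> 'a \<Rightarrow> 'a" where
  "sphere_proj y v = v - (v \<bullet> y) *\<^sub>R y"

text \<open>
  The Levi-Civita connection of the round metric is the tangential part of the derivative in the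
  ambient Euclidean space. Vector fields on the sphere are given by functions on the ambient
  space; at a point of the sphere only their values along the sphere matter.
\<close>
definition sphere_conn :: "('a::euclidean_space \<Rightarrow> 'a) \<Rightarrow> ('a \<Rightarrow> 'a) \<Rightarrow> 'a \<Rightarrow> 'a" where
  "sphere_conn X Y y = sphere_proj y (frechet_derivative Y (at y) (X y))"

text \<open>
  The curvature tensor at \<open>y\<close> on tangent vectors \<open>a\<close>, \<open>b\<close>, \<open>c\<close>, each extended to the tangent
  vector field of its projections; by tensoriality the choice of extension is immaterial.
\<close>
definition sphere_curvature :: "'a::euclidean_space \<Rightarrow> 'a \<Rightarrow> 'a \<Rightarrow> 'a \<Rightarrow> 'a" where
  "sphere_curvature y a b c =
     curvature sphere_conn (\<lambda>z. sphere_proj z a) (\<lambda>z. sphere_proj z b) (\<lambda>z. sphere_proj z c) y"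


section \<open>Harmonic and biharmonic maps into the sphere\<close>

text \<open>
  Here \<open>g\<close> is a metric on a coordinate domain, \<open>f\<close> a map from it into the unit sphere and \<open>V\<close> a
  section of the pull-back of the tangent bundle of the sphere, i.e. \<open>V u\<close> is orthogonal to
  \<open>f u\<close>. Indices refer to coordinate vector fields. \<open>cov\<close> is the pull-back connection.
\<close>
definition cov ::
  "(real ^ 'm::finite \<Rightarrow> 'a::euclidean_space) \<Rightarrow> 'm \<Rightarrow> (real ^ 'm \<Rightarrow> 'a) \<Rightarrow> real ^ 'm \<Rightarrow> 'a" where
  "cov f i V u = sphere_proj (f u) (pd i V u)"

definition nabla_df ::
  "(real ^ 'm \<Rightarrow> real ^ 'm ^ 'm) \<Rightarrow> (real ^ 'm::finite \<Rightarrow> 'a::euclidean_space)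
     \<Rightarrow> real ^ 'm \<Rightarrow> 'm \<Rightarrow> 'm \<Rightarrow> 'a" where
  "nabla_df g f u i j =
     cov f i (pd j f) u - (\<Sum>k\<in>UNIV. christoffel g k i j u *\<^sub>R pd k f u)"

definition tension ::
  "(real ^ 'm \<Rightarrow> real ^ 'm ^ 'm) \<Rightarrow> (real ^ 'm::finite \<Rightarrow> 'a::euclidean_space)
     \<Rightarrow> real ^ 'm \<Rightarrow> 'a" where
  "tension g f u = metric_trace (g u) (nabla_df g f u)"

definition nabla2 ::
  "(real ^ 'm \<Rightarrow> real ^ 'm ^ 'm) \<Rightarrow> (real ^ 'm::finite \<Rightarrow> 'a::euclidean_space)
     \<Rightarrow> (real ^ 'm \<Rightarrow> 'a) \<Rightarrow> real ^ 'm \<Rightarrow> 'm \<Rightarrow> 'm \<Rightarrow> 'a" where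
  "nabla2 g f V u i j =
     cov f i (cov f j V) u - (\<Sum>k\<in>UNIV. christoffel g k i j u *\<^sub>R cov f k V u)"

definition rough_laplacian ::
  "(real ^ 'm \<Rightarrow> real ^ 'm ^ 'm) \<Rightarrow> (real ^ 'm::finite \<Rightarrow> 'a::euclidean_space)
     \<Rightarrow> (real ^ 'm \<Rightarrow> 'a) \<Rightarrow> real ^ 'm \<Rightarrow> 'a" where
  "rough_laplacian g f V u = - metric_trace (g u) (nabla2 g f V u)"

definition bitension ::
  "(real ^ 'm \<Rightarrow> real ^ 'm ^ 'm) \<Rightarrow> (real ^ 'm::finite \<Rightarrow> 'a::euclidean_space)
     \<Rightarrow> real ^ 'm \<Rightarrow> 'a" where
  "bitension g f u =
     - rough_laplacian g f (tension g f) u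
     - metric_trace (g u) (\<lambda>i j. sphere_curvature (f u) (pd i f u) (tension g f u) (pd j f u))"

definition induced_metric ::
  "(real ^ 'm::finite \<Rightarrow> 'a::euclidean_space) \<Rightarrow> real ^ 'm \<Rightarrow> real ^ 'm ^ 'm" where
  "induced_metric f u = (\<chi> i j. pd i f u \<bullet> pd j f u)"

definition harmonic_immersion ::
  "((real ^ 'm::finite) set \<times> (real ^ 'm \<Rightarrow> 'p)) set \<Rightarrow> ('p \<Rightarrow> 'a::euclidean_space) \<Rightarrow> bool" where
  "harmonic_immersion \<A> \<phi> \<longleftrightarrow>
     (\<forall>(U, x)\<in>\<A>. \<forall>u\<in>U. tension (induced_metric (\<phi> \<circ> x)) (\<phi> \<circ> x) u = 0)"

definition biharmonic_immersion ::
  "((real ^ 'm::finite) set \<times> (real ^ 'm \<Rightarrow> 'p)) set \<Rightarrow> ('p \<Rightarrow> 'a::euclidean_space) \<Rightarrow> bool" where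
  "biharmonic_immersion \<A> \<phi> \<longleftrightarrow>
     (\<forall>(U, x)\<in>\<A>. \<forall>u\<in>U. bitension (induced_metric (\<phi> \<circ> x)) (\<phi> \<circ> x) u = 0)"

definition proper_biharmonic ::
  "((real ^ 'm::finite) set \<times> (real ^ 'm \<Rightarrow> 'p)) set \<Rightarrow> ('p \<Rightarrow> 'a::euclidean_space) \<Rightarrow> bool" where
  "proper_biharmonic \<A> \<phi> \<longleftrightarrow> biharmonic_immersion \<A> \<phi> \<and> \<not> harmonic_immersion \<A> \<phi>"


section \<open>Extrinsic geometry of a submanifold of the sphere\<close>

text \<open>
  Here \<open>f\<close> is an immersion of a coordinate domain into the sphere. A tangent vector of the
  submanifold is given by its coordinates; the range of the derivative of \<open>f\<close> at \<open>u\<close> is the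
  tangent space as a subspace of the ambient space.
\<close>
definition normal_part ::
  "(real ^ 'm::finite \<Rightarrow> 'a::euclidean_space) \<Rightarrow> real ^ 'm \<Rightarrow> 'a \<Rightarrow> 'a" where
  "normal_part f u v =
     (THE n. (\<forall>t \<in> range (frechet_derivative f (at u)). n \<bullet> t = 0) \<and>
             v - n \<in> range (frechet_derivative f (at u)))"

definition second_ff_coord ::
  "(real ^ 'm::finite \<Rightarrow> 'a::euclidean_space) \<Rightarrow> real ^ 'm \<Rightarrow> 'm \<Rightarrow> 'm \<Rightarrow> 'a" where
  "second_ff_coord f u i j = normal_part f u (cov f i (pd j f) u)"

definition second_ff ::
  "(real ^ 'm::finite \<Rightarrow> 'a::euclidean_space) \<Rightarrow> real ^ 'm \<Rightarrow> real ^ 'm \<Rightarrow> real ^ 'm \<Rightarrow> 'a" where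
  "second_ff f u v w = (\<Sum>i\<in>UNIV. \<Sum>j\<in>UNIV. (v $ i * w $ j) *\<^sub>R second_ff_coord f u i j)"

definition mean_curvature ::
  "(real ^ 'm::finite \<Rightarrow> 'a::euclidean_space) \<Rightarrow> real ^ 'm \<Rightarrow> 'a" where
  "mean_curvature f u =
     (1 / real CARD('m)) *\<^sub>R metric_trace (induced_metric f u) (second_ff_coord f u)"

definition normal_conn ::
  "(real ^ 'm::finite \<Rightarrow> 'a::euclidean_space) \<Rightarrow> 'm \<Rightarrow> (real ^ 'm \<Rightarrow> 'a) \<Rightarrow> real ^ 'm \<Rightarrow> 'a" where
  "normal_conn f i \<xi> u = normal_part f u (cov f i \<xi> u)"

definition weingarten ::
  "(real ^ 'm::finite \<Rightarrow> 'a::euclidean_space) \<Rightarrow> real ^ 'm \<Rightarrow> 'a \<Rightarrow> real ^ 'm \<Rightarrow> real ^ 'm" where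
  "weingarten f u \<xi> v =
     (THE w. \<forall>t. metric_prod (induced_metric f u) w t = second_ff f u v t \<bullet> \<xi>)"

definition parallel_mean_curvature ::
  "((real ^ 'm::finite) set \<times> (real ^ 'm \<Rightarrow> 'p)) set \<Rightarrow> ('p \<Rightarrow> 'a::euclidean_space) \<Rightarrow> bool" where
  "parallel_mean_curvature \<A> \<phi> \<longleftrightarrow>
     (\<forall>(U, x)\<in>\<A>. \<forall>u\<in>U. \<forall>i. normal_conn (\<phi> \<circ> x) i (mean_curvature (\<phi> \<circ> x)) u = 0)"

text \<open>
  A family indexed by \<open>'m\<close> which is orthonormal for a metric on a \<open>CARD('m)\<close>-dimensional tangent
  space is automatically a basis.
\<close>
definition orthonormal_basis :: "real ^ 'm ^ 'm \<Rightarrow> ('m::finite \<Rightarrow> real ^ 'm) \<Rightarrow> bool" where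
  "orthonormal_basis G e \<longleftrightarrow> (\<forall>i j. metric_prod G (e i) (e j) = (if i = j then 1 else 0))"

definition frame_curvature ::
  "(real ^ 'm \<Rightarrow> real ^ 'm ^ 'm) \<Rightarrow> real ^ 'm::finite \<Rightarrow> ('m \<Rightarrow> real ^ 'm) \<Rightarrow> 'm \<Rightarrow> 'm \<Rightarrow> real" where
  "frame_curvature g u e i j = (if i = j then 0 else sectional_curvature g u (e i) (e j))"

end

theory Submission
  imports Defs
begin

text \<open>
  For parallel \<open>H\<close>, the normal part of the bitension field is \<open>m\<close> times
  \<open>m H - \<Sum>\<^sub>k B(e\<^sub>k, A\<^sub>H e\<^sub>k)\<close>, so biharmonicity gives \<open>\<Sum>\<^sub>k a\<^sub>k B(e\<^sub>k, e\<^sub>k) = m H = \<Sum>\<^sub>k B(e\<^sub>k, e\<^sub>k)\<close>;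
  pairing both sums with \<open>H\<close> yields (i). By the Gauss equation,
  \<open>K\<^sub>i\<^sub>j + |B(e\<^sub>i, e\<^sub>j)|\<^sup>2 = 1 - \<delta>\<^sub>i\<^sub>j + B(e\<^sub>i, e\<^sub>i) \<bullet> B(e\<^sub>j, e\<^sub>j)\<close>, also on the diagonal, where \<open>K\<^sub>i\<^sub>i = 0\<close>.
  Summing this against \<open>a\<^sub>i + a\<^sub>j\<close> and \<open>a\<^sub>i a\<^sub>j\<close> gives (ii) and (iii).
\<close>

section \<open>Directional derivatives\<close>

text \<open>The direction comes first, so that \<open>dird v h\<close> is itself a function that can
  be differentiated again.\<close>

definition dird :: "'a::real_normed_vector \<Rightarrow> ('a \<Rightarrow> 'b::real_normed_vector) \<Rightarrow> 'a \<Rightarrow> 'b" where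
  "dird v h u = frechet_derivative h (at u) v"

lemma pd_eq_dird: "pd i h = dird (axis i 1) h"
  by (simp add: fun_eq_iff pd_def dird_def)

lemma dird_has_derivative:
  "h differentiable (at u) \<Longrightarrow> (h has_derivative (\<lambda>v. dird v h u)) (at u)"
  unfolding dird_def using frechet_derivative_works by blast

lemma dird_eq: "(h has_derivative D) (at u) \<Longrightarrow> dird v h u = D v"
  unfolding dird_def using frechet_derivative_at by metis

lemma linear_dird: "h differentiable (at u) \<Longrightarrow> linear (\<lambda>v. dird v h u)"
  using dird_has_derivative has_derivative_linear by blast

lemma dird_cong:
  assumes "open U" "u \<in> U" "\<And>y. y \<in> U \<Longrightarrow> h y = k y"
  shows "dird v h u = dird v k u"
proof (cases "h differentiable (at u)")
  case True
  from has_derivative_transform_within_open[OF dird_has_derivative[OF True] assms]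
  show ?thesis using dird_eq by metis
next
  case False
  \<comment> \<open>\<open>frechet_derivative\<close> is a Hilbert choice. Both functions have the
    same derivatives at \<open>u\<close>, so the choices agree even when there is no
    derivative.\<close>
  have "(h has_derivative D) (at u) = (k has_derivative D) (at u)" for D
    using assms has_derivative_transform_within_open by (metis)
  then show ?thesis by (simp add: dird_def frechet_derivative_def)
qed

lemma differentiable_cong_open:
  assumes "open U" "u \<in> U" "\<And>y. y \<in> U \<Longrightarrow> h y = k y" "k differentiable (at u)"
  shows "h differentiable (at u)"
  using assms has_derivative_transform_within_open unfolding differentiable_def by metis

lemma smooth_on_differentiable: "smooth_on U h \<Longrightarrow> u \<in> U \<Longrightarrow> h differentiable (at u)"
  unfolding smooth_on_def by (metis Ck_on.simps(2))

lemma smooth_on_dird: "smooth_on U h \<Longrightarrow> smooth_on U (dird v h)"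
  unfolding smooth_on_def dird_def by (metis Ck_on.simps(2))

lemma smooth_on_continuous: "smooth_on U h \<Longrightarrow> continuous_on U h"
  unfolding smooth_on_def by (metis Ck_on.simps(1))

lemma dird_const [simp]: "dird v (\<lambda>_. c) u = 0"
  by (simp add: dird_def)

lemma dird_inner:
  fixes h k :: "'a::real_normed_vector \<Rightarrow> 'b::real_inner"
  assumes "h differentiable (at u)" "k differentiable (at u)"
  shows "dird v (\<lambda>y. h y \<bullet> k y) u = dird v h u \<bullet> k u + h u \<bullet> dird v k u"
  using dird_eq[OF has_derivative_inner[OF assms[THEN dird_has_derivative]]] by simp

lemma dird_diff:
  assumes "h differentiable (at u)" "k differentiable (at u)"
  shows "dird v (\<lambda>y. h y - k y) u = dird v h u - dird v k u"
  using dird_eq[OF has_derivative_diff[OF assms[THEN dird_has_derivative]]] by simp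

section \<open>Symmetry of second derivatives\<close>

lemma line_derivative:
  fixes h :: "'a::real_normed_vector \<Rightarrow> real"
  assumes "h differentiable (at (a + s *\<^sub>R v))"
  shows "((\<lambda>s. h (a + s *\<^sub>R v)) has_real_derivative dird v h (a + s *\<^sub>R v)) (at s)"
proof -
  have "((\<lambda>s. a + s *\<^sub>R v) has_derivative (\<lambda>r. r *\<^sub>R v)) (at s)"
    by (auto intro!: derivative_eq_intros)
  from has_derivative_compose[OF this, of h, OF dird_has_derivative[OF assms]]
  have "((\<lambda>s. h (a + s *\<^sub>R v)) has_derivative (\<lambda>r. dird (r *\<^sub>R v) h (a + s *\<^sub>R v))) (at s)" .
  moreover have "(\<lambda>r. dird (r *\<^sub>R v) h (a + s *\<^sub>R v)) = (*) (dird v h (a + s *\<^sub>R v))"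
    using linear_scale[OF linear_dird[OF assms]] by (auto simp: mult.commute)
  ultimately show ?thesis by (simp add: has_field_derivative_def)
qed

text \<open>The mean value theorem is applied twice: along \<open>v\<close> to the increment in
  \<open>w\<close>, then along \<open>w\<close> to \<open>dird v h\<close>. The second difference is
  symmetric in \<open>v\<close> and \<open>w\<close>, which lets the result be compared with its
  swapped version.\<close>

lemma second_difference_mvt:
  fixes h :: "'a::real_normed_vector \<Rightarrow> real"
  assumes r: "0 < r"
    and d1: "\<And>s t. 0 \<le> s \<Longrightarrow> s \<le> r \<Longrightarrow> 0 \<le> t \<Longrightarrow> t \<le> r \<Longrightarrow>
      h differentiable (at (u + s *\<^sub>R v + t *\<^sub>R w))"
    and d2: "\<And>s t. 0 \<le> s \<Longrightarrow> s \<le> r \<Longrightarrow> 0 \<le> t \<Longrightarrow> t \<le> r \<Longrightarrow>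
      dird v h differentiable (at (u + s *\<^sub>R v + t *\<^sub>R w))"
  obtains s t where "0 < s" "s < r" "0 < t" "t < r"
    "h (u + r *\<^sub>R v + r *\<^sub>R w) - h (u + r *\<^sub>R v) - h (u + r *\<^sub>R w) + h u =
      r\<^sup>2 * dird w (dird v h) (u + s *\<^sub>R v + t *\<^sub>R w)"
proof -
  define P where "P s = h (u + r *\<^sub>R w + s *\<^sub>R v) - h (u + s *\<^sub>R v)" for s
  have "DERIV P s :> dird v h (u + r *\<^sub>R w + s *\<^sub>R v) - dird v h (u + s *\<^sub>R v)"
    if "0 \<le> s" "s \<le> r" for s
    unfolding P_def
    by (intro DERIV_diff line_derivative) (use d1[of s r] d1[of s 0] that r in \<open>auto simp: ac_simps\<close>)
  from MVT2[OF r this] obtain s where s: "0 < s" "s < r"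
    and "P r - P 0 = (r - 0) * (dird v h (u + r *\<^sub>R w + s *\<^sub>R v) - dird v h (u + s *\<^sub>R v))"
    by blast
  then have eq: "P r - P 0 = r * (dird v h (u + s *\<^sub>R v + r *\<^sub>R w) - dird v h (u + s *\<^sub>R v))"
    by (simp add: ac_simps)
  define Q where "Q t = dird v h (u + s *\<^sub>R v + t *\<^sub>R w)" for t
  have "DERIV Q t :> dird w (dird v h) (u + s *\<^sub>R v + t *\<^sub>R w)"
    if "0 \<le> t" "t \<le> r" for t
    unfolding Q_def by (intro line_derivative d2) (use s that in auto)
  from MVT2[OF r this] obtain t where t: "0 < t" "t < r"
    and "Q r - Q 0 = (r - 0) * dird w (dird v h) (u + s *\<^sub>R v + t *\<^sub>R w)"
    by blast
  with eq have "P r - P 0 = r\<^sup>2 * dird w (dird v h) (u + s *\<^sub>R v + t *\<^sub>R w)"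
    by (simp add: Q_def power2_eq_square)
  then show thesis using that[OF s t] by (simp add: P_def algebra_simps)
qed

text \<open>If the mixed derivatives differed at \<open>u\<close>, continuity would keep each within
  half the gap of its value there. Yet \<open>second_difference_mvt\<close>, used in both orders on
  a small parallelogram, gives nearby points at which they agree.\<close>

lemma dird_commute_real:
  fixes h :: "'a::euclidean_space \<Rightarrow> real"
  assumes "open U" "u \<in> U" and h: "smooth_on U h"
  shows "dird v (dird w h) u = dird w (dird v h) u"
proof (rule ccontr)
  define A B where "A = dird w (dird v h)" and "B = dird v (dird w h)"
  assume "\<not> ?thesis"
  then have pos: "\<bar>A u - B u\<bar> / 2 > 0" by (auto simp: A_def B_def)
  have "isCont A u" "isCont B u"
    using h assms smooth_on_continuous smooth_on_dird continuous_on_eq_continuous_at A_def B_def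
    by metis+
  then obtain d1 d2 where d: "d1 > 0" "d2 > 0"
    "\<And>y. dist y u < d1 \<Longrightarrow> \<bar>A y - A u\<bar> < \<bar>A u - B u\<bar> / 2"
    "\<And>y. dist y u < d2 \<Longrightarrow> \<bar>B y - B u\<bar> < \<bar>A u - B u\<bar> / 2"
    using pos unfolding continuous_at_eps_delta dist_real_def by metis
  obtain d3 where d3: "d3 > 0" "ball u d3 \<subseteq> U" using assms openE by blast
  define d where "d = min d3 (min d1 d2)"
  \<comment> \<open>This size keeps the parallelogram with sides \<open>r *\<^sub>R v\<close> and
    \<open>r *\<^sub>R w\<close> within distance \<open>d\<close> of \<open>u\<close>; the summand 1
    makes the bound strict and the denominator positive.\<close>
  define r where "r = d / (norm v + norm w + 1)"
  have "d > 0" using d d3 by (simp add: d_def)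
  then have r: "r > 0" by (auto simp: r_def divide_simps add_nonneg_pos)
  have near: "dist (u + s *\<^sub>R v + t *\<^sub>R w) u < d" if "0 \<le> s" "s \<le> r" "0 \<le> t" "t \<le> r" for s t
  proof -
    have "dist (u + s *\<^sub>R v + t *\<^sub>R w) u = norm (s *\<^sub>R v + t *\<^sub>R w)"
      by (simp add: dist_norm algebra_simps)
    also have "\<dots> \<le> s * norm v + t * norm w"
      using norm_triangle_ineq[of "s *\<^sub>R v" "t *\<^sub>R w"] that by simp
    also have "\<dots> \<le> r * norm v + r * norm w" using that by (intro add_mono mult_right_mono) auto
    also have "\<dots> < r * (norm v + norm w + 1)" using r by (simp add: algebra_simps)
    also have "\<dots> = d" by (simp add: r_def add_nonneg_pos less_imp_neq[symmetric])
    finally show ?thesis .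
  qed
  have inU: "u + s *\<^sub>R v + t *\<^sub>R w \<in> U" if "0 \<le> s" "s \<le> r" "0 \<le> t" "t \<le> r" for s t
    using near[OF that] d3 by (auto simp: d_def dist_commute)
  note diff = smooth_on_differentiable[OF h] smooth_on_differentiable[OF smooth_on_dird[OF h]]
  obtain s t where st: "0 < s" "s < r" "0 < t" "t < r" and
    1: "h (u + r *\<^sub>R v + r *\<^sub>R w) - h (u + r *\<^sub>R v) - h (u + r *\<^sub>R w) + h u =
      r\<^sup>2 * A (u + s *\<^sub>R v + t *\<^sub>R w)"
    unfolding A_def
    by (rule second_difference_mvt[of r h u v w, OF r diff(1)[OF inU] diff(2)[OF inU]])
  have inU': "u + s *\<^sub>R w + t *\<^sub>R v \<in> U" if "0 \<le> s" "s \<le> r" "0 \<le> t" "t \<le> r" for s t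
    using inU[of t s] that by (simp add: ac_simps)
  obtain s' t' where st': "0 < s'" "s' < r" "0 < t'" "t' < r" and
    2: "h (u + r *\<^sub>R w + r *\<^sub>R v) - h (u + r *\<^sub>R w) - h (u + r *\<^sub>R v) + h u =
      r\<^sup>2 * B (u + s' *\<^sub>R w + t' *\<^sub>R v)"
    unfolding B_def
    by (rule second_difference_mvt[of r h u w v, OF r diff(1)[OF inU'] diff(2)[OF inU']])
  have 2: "h (u + r *\<^sub>R v + r *\<^sub>R w) - h (u + r *\<^sub>R w) - h (u + r *\<^sub>R v) + h u =
      r\<^sup>2 * B (u + t' *\<^sub>R v + s' *\<^sub>R w)"
    using 2 by (simp add: ac_simps)
  have "r\<^sup>2 * A (u + s *\<^sub>R v + t *\<^sub>R w) = r\<^sup>2 * B (u + t' *\<^sub>R v + s' *\<^sub>R w)"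
    using 1 2 by linarith
  then have "A (u + s *\<^sub>R v + t *\<^sub>R w) = B (u + t' *\<^sub>R v + s' *\<^sub>R w)" using r by simp
  moreover have "\<bar>A (u + s *\<^sub>R v + t *\<^sub>R w) - A u\<bar> < \<bar>A u - B u\<bar> / 2"
    using d(3) near[of s t] st by (simp add: d_def)
  moreover have "\<bar>B (u + t' *\<^sub>R v + s' *\<^sub>R w) - B u\<bar> < \<bar>A u - B u\<bar> / 2"
    using d(4) near[of t' s'] st' by (simp add: d_def)
  ultimately show False by (smt (verit) field_sum_of_halves)
qed

lemma dird_inner_left:
  fixes h :: "'a::real_normed_vector \<Rightarrow> 'b::real_inner"
  assumes "h differentiable (at u)"
  shows "dird v (\<lambda>y. h y \<bullet> c) u = dird v h u \<bullet> c"
  using dird_inner[OF assms differentiable_const] by (simp add: dird_def)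

lemma Ck_on_cong:
  assumes "open U"
  shows "(\<And>y. y \<in> U \<Longrightarrow> h y = k y) \<Longrightarrow> Ck_on n U h \<longleftrightarrow> Ck_on n U k"
proof (induction n arbitrary: h k)
  case 0
  then show ?case by simp
next
  case (Suc n)
  have "frechet_derivative h (at u) v = frechet_derivative k (at u) v" if "u \<in> U" for u v
    using dird_cong[OF assms that Suc.prems] by (simp add: dird_def)
  moreover have "h differentiable (at u) \<longleftrightarrow> k differentiable (at u)" if "u \<in> U" for u
    using differentiable_cong_open[OF assms that] Suc.prems by metis
  ultimately show ?case
    using Suc.IH[of "\<lambda>u. frechet_derivative h (at u) v" "\<lambda>u. frechet_derivative k (at u) v" for v]
    by auto
qed

lemma smooth_on_inner_left:
  fixes h :: "'a::euclidean_space \<Rightarrow> 'b::real_inner"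
  assumes "open U" "smooth_on U h"
  shows "smooth_on U (\<lambda>y. h y \<bullet> c)"
proof -
  have "Ck_on n U h \<Longrightarrow> Ck_on n U (\<lambda>y. h y \<bullet> c)" for n and h :: "'a \<Rightarrow> 'b"
  proof (induction n arbitrary: h)
    case 0
    then show ?case by (auto intro!: continuous_intros)
  next
    case (Suc n)
    then have d: "\<And>u. u \<in> U \<Longrightarrow> h differentiable (at u)"
      and ck: "\<And>v. Ck_on n U (\<lambda>u. frechet_derivative h (at u) v \<bullet> c)"
      by auto
    moreover have "Ck_on n U (\<lambda>u. frechet_derivative (\<lambda>y. h y \<bullet> c) (at u) v)" for v
      using ck[of v] dird_inner_left[OF d] Ck_on_cong[OF assms(1)] unfolding dird_def
      by (metis (no_types, lifting))
    ultimately show ?case by (auto intro: differentiable_inner)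
  qed
  then show ?thesis using assms(2) by (simp add: smooth_on_def)
qed

text \<open>Pairing with a fixed vector commutes with differentiation, so the real-valued case
  applies to each component.\<close>

lemma dird_commute:
  fixes h :: "'a::euclidean_space \<Rightarrow> 'b::euclidean_space"
  assumes U: "open U" "u \<in> U" and h: "smooth_on U h"
  shows "dird v (dird w h) u = dird w (dird v h) u"
proof (rule euclidean_eqI)
  fix b :: 'b
  have "dird v (dird w h) u \<bullet> b = dird v (dird w (\<lambda>y. h y \<bullet> b)) u" for v w
  proof -
    have "dird v (dird w (\<lambda>y. h y \<bullet> b)) u = dird v (\<lambda>y. dird w h y \<bullet> b) u"
      by (intro dird_cong[OF U] dird_inner_left smooth_on_differentiable[OF h])
    then show ?thesis
      using smooth_on_differentiable[OF smooth_on_dird[OF h] U(2)] by (simp add: dird_inner_left)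
  qed
  then show "dird v (dird w h) u \<bullet> b = dird w (dird v h) u \<bullet> b"
    using dird_commute_real[OF U smooth_on_inner_left[OF U(1) h]] by simp
qed

section \<open>Matrices and traces\<close>

lemma linear_axis_expansion:
  fixes L :: "real ^ 'm::finite \<Rightarrow> 'b::real_vector"
  assumes "linear L"
  shows "L v = (\<Sum>i\<in>UNIV. v $ i *\<^sub>R L (axis i 1))"
proof -
  have "L v = L (\<Sum>i\<in>UNIV. v $ i *\<^sub>R axis i 1)"
    using basis_expansion[of v] by (simp add: scalar_mult_eq_scaleR)
  then show ?thesis using assms by (simp add: linear_sum linear_scale)
qed

lemma bilinear_axis_expansion:
  fixes T :: "real ^ 'm::finite \<Rightarrow> real ^ 'm \<Rightarrow> 'b::real_vector"
  assumes "\<And>w. linear (\<lambda>v. T v w)" "\<And>v. linear (\<lambda>w. T v w)"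
  shows "T v w = (\<Sum>i\<in>UNIV. \<Sum>j\<in>UNIV. (v $ i * w $ j) *\<^sub>R T (axis i 1) (axis j 1))"
proof -
  have "T v w = (\<Sum>i\<in>UNIV. v $ i *\<^sub>R T (axis i 1) w)"
    by (rule linear_axis_expansion[OF assms(1)])
  also have "\<dots> = (\<Sum>i\<in>UNIV. v $ i *\<^sub>R (\<Sum>j\<in>UNIV. w $ j *\<^sub>R T (axis i 1) (axis j 1)))"
    by (intro sum.cong refl arg_cong2[of _ _ _ _ "(*\<^sub>R)"] linear_axis_expansion[OF assms(2)])
  finally show ?thesis by (simp add: scaleR_sum_right)
qed

lemma matrix_inv_left:
  fixes A :: "real ^ 'm ^ 'm::finite"
  assumes "det A \<noteq> 0"
  shows "matrix_inv A ** A = mat 1" and matrix_inv_right: "A ** matrix_inv A = mat 1"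
  using assms someI_ex[of "\<lambda>A'. A ** A' = mat 1 \<and> A' ** A = mat 1"]
  by (auto simp: invertible_det_nz[symmetric] invertible_def matrix_inv_def)

text \<open>Cramer's rule for column \<open>l\<close> of the inverse. As quotients of determinants,
  the entries are visibly differentiable in those of \<open>A\<close>.\<close>

lemma matrix_inv_entry:
  fixes A :: "real ^ 'm ^ 'm::finite"
  assumes "det A \<noteq> 0"
  shows "matrix_inv A $ k $ l = det (\<chi> i j. if j = k then axis l 1 $ i else A $ i $ j) / det A"
proof -
  have "A *v (matrix_inv A *v axis l 1) = axis l 1"
    by (simp add: matrix_vector_mul_assoc matrix_inv_right[OF assms])
  then have "matrix_inv A *v axis l 1 =
      (\<chi> k. det (\<chi> i j. if j = k then axis l 1 $ i else A $ i $ j) / det A)"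
    using cramer[OF assms] by blast
  then show ?thesis by (simp add: vec_eq_iff matrix_vector_mult_basis column_def)
qed

lemma differentiable_prod:
  fixes h :: "'i \<Rightarrow> 'a::real_normed_vector \<Rightarrow> real"
  assumes "\<And>i. i \<in> I \<Longrightarrow> h i differentiable (at u)"
  shows "(\<lambda>y. \<Prod>i\<in>I. h i y) differentiable (at u)"
  using has_derivative_prod[of I h _ u UNIV] assms unfolding differentiable_def by metis

lemma differentiable_det:
  fixes A :: "'a::real_normed_vector \<Rightarrow> real ^ 'm ^ 'm::finite"
  assumes "\<And>i j. (\<lambda>y. A y $ i $ j) differentiable (at u)"
  shows "(\<lambda>y. det (A y)) differentiable (at u)"
  unfolding det_def by (intro differentiable_sum differentiable_mult differentiable_prod assms ballI) auto

lemma differentiable_matrix_inv: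
  fixes A :: "'a::real_normed_vector \<Rightarrow> real ^ 'm ^ 'm::finite"
  assumes U: "open U" "u \<in> U" "\<And>y. y \<in> U \<Longrightarrow> det (A y) \<noteq> 0"
    and A: "\<And>i j. (\<lambda>y. A y $ i $ j) differentiable (at u)"
  shows "(\<lambda>y. matrix_inv (A y) $ k $ l) differentiable (at u)"
proof (rule differentiable_cong_open[OF U(1,2)])
  show "matrix_inv (A y) $ k $ l =
      det (\<chi> i j. if j = k then axis l 1 $ i else A y $ i $ j) / det (A y)" if "y \<in> U" for y
    using matrix_inv_entry U(3) that by blast
  have "(\<lambda>y. (\<chi> i j. if j = k then axis l 1 $ i else A y $ i $ j :: real ^ 'm ^ 'm) $ i $ j)
      differentiable (at u)" for i j
    using A by (cases "j = k") auto
  then show "(\<lambda>y. det (\<chi> i j. if j = k then axis l 1 $ i else A y $ i $ j) / det (A y))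
      differentiable (at u)"
    using U by (intro differentiable_divide differentiable_det A) auto
qed

lemma differentiable_vec_lambda:
  fixes Z :: "'a::real_normed_vector \<Rightarrow> real ^ 'm::finite"
  assumes "\<And>i. (\<lambda>y. Z y $ i) differentiable (at u)"
  shows "Z differentiable (at u)"
proof -
  have "Z = (\<lambda>y. \<Sum>i\<in>UNIV. Z y $ i *\<^sub>R axis i 1)"
    by (rule ext) (rule linear_axis_expansion[OF linear_ident])
  moreover have "(\<lambda>y. \<Sum>i\<in>UNIV. Z y $ i *\<^sub>R axis i 1) differentiable (at u)"
    using assms by (intro differentiable_sum differentiable_scaleR ballI) auto
  ultimately show ?thesis by (rule ssubst[where P = "\<lambda>Z. Z differentiable (at u)"])
qed

text \<open>With the frame vectors as columns of \<open>E\<close>, orthonormality reads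
  \<open>transpose E ** A ** E = mat 1\<close>. Hence
  \<open>matrix_inv A = E ** transpose E\<close>, which turns contraction with the inverse metric
  into a sum over the frame.\<close>

lemma metric_trace_orthonormal:
  fixes A :: "real ^ 'm ^ 'm::finite" and T :: "real ^ 'm \<Rightarrow> real ^ 'm \<Rightarrow> 'b::real_vector"
  assumes "orthonormal_basis A e" "\<And>w. linear (\<lambda>v. T v w)" "\<And>v. linear (\<lambda>w. T v w)"
  shows "metric_trace A (\<lambda>i j. T (axis i 1) (axis j 1)) = (\<Sum>k\<in>UNIV. T (e k) (e k))"
proof -
  define E :: "real ^ 'm ^ 'm" where "E = (\<chi> i k. e k $ i)"
  have "transpose E ** A ** E = mat 1"
  proof -
    have "(transpose E ** A ** E) $ k $ l = metric_prod A (e k) (e l)" for k l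
      by (simp add: matrix_mul_assoc[symmetric])
        (simp add: matrix_matrix_mult_def transpose_def E_def metric_prod_def inner_vec_def
          matrix_vector_mult_def)
    then show ?thesis using assms(1) by (simp add: vec_eq_iff orthonormal_basis_def mat_def)
  qed
  then have right: "(E ** transpose E) ** A = mat 1"
    by (metis matrix_left_right_inverse matrix_mul_assoc)
  then have "A ** (E ** transpose E) = mat 1" by (metis matrix_left_right_inverse)
  moreover have "det A \<noteq> 0"
    using right by (metis invertible_det_nz invertible_left_inverse)
  ultimately have "matrix_inv A = E ** transpose E"
    by (metis matrix_inv_left matrix_mul_assoc matrix_mul_lid matrix_mul_rid)
  then have inv: "matrix_inv A $ i $ j = (\<Sum>k\<in>UNIV. e k $ i * e k $ j)" for i j
    by (simp add: matrix_matrix_mult_def transpose_def E_def)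
  have "(\<Sum>k\<in>UNIV. T (e k) (e k)) =
      (\<Sum>k\<in>UNIV. \<Sum>i\<in>UNIV. \<Sum>j\<in>UNIV. (e k $ i * e k $ j) *\<^sub>R T (axis i 1) (axis j 1))"
    by (intro sum.cong refl bilinear_axis_expansion assms)
  also have "\<dots> = (\<Sum>i\<in>UNIV. \<Sum>j\<in>UNIV. \<Sum>k\<in>UNIV. (e k $ i * e k $ j) *\<^sub>R T (axis i 1) (axis j 1))"
    by (subst sum.swap) (intro sum.cong refl sum.swap)
  finally show ?thesis by (simp add: metric_trace_def inv scaleR_sum_left)
qed

section \<open>Curvature of the sphere\<close>

text \<open>Constant curvature one. The bracket of the projected fields vanishes at
  \<open>y\<close>, so only the two second covariant derivatives contribute.\<close>

lemma sphere_curvature_eq: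
  assumes y: "norm y = 1" and ortho: "a \<bullet> y = 0" "b \<bullet> y = 0" "c \<bullet> y = 0"
  shows "sphere_curvature y a b c = (b \<bullet> c) *\<^sub>R a - (a \<bullet> c) *\<^sub>R b"
proof -
  have yy: "y \<bullet> y = 1" using y by (simp add: dot_square_norm)
  have proj: "frechet_derivative (\<lambda>z. sphere_proj z c) (at z) h = - ((c \<bullet> h) *\<^sub>R z + (c \<bullet> z) *\<^sub>R h)"
    for c z h :: 'a
  proof -
    have "((\<lambda>z. sphere_proj z c) has_derivative (\<lambda>h. - ((c \<bullet> h) *\<^sub>R z + (c \<bullet> z) *\<^sub>R h))) (at z)"
      unfolding sphere_proj_def by (auto intro!: derivative_eq_intros simp: algebra_simps)
    from frechet_derivative_at[OF this] show ?thesis by metis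
  qed
  have conn2: "sphere_conn (\<lambda>z. sphere_proj z a)
      (sphere_conn (\<lambda>z. sphere_proj z b) (\<lambda>z. sphere_proj z c)) y = - (a \<bullet> c) *\<^sub>R b"
    if ortho: "a \<bullet> y = 0" "b \<bullet> y = 0" "c \<bullet> y = 0" for a b c
  proof -
    define Y where "Y z = b - (b \<bullet> z) *\<^sub>R z" for z
    define DY where "DY h = - ((b \<bullet> h) *\<^sub>R y + (b \<bullet> y) *\<^sub>R h)" for h
    define S where "S z = - ((c \<bullet> Y z) *\<^sub>R z + (c \<bullet> z) *\<^sub>R Y z)" for z
    \<comment> \<open>The identity is stated off the sphere as well, because the outer connection
      differentiates in the ambient space.\<close>
    have conn: "sphere_conn (\<lambda>z. sphere_proj z b) (\<lambda>z. sphere_proj z c) = (\<lambda>z. S z - (S z \<bullet> z) *\<^sub>R z)"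
      by (rule ext) (simp add: sphere_conn_def proj S_def Y_def, simp add: sphere_proj_def)
    have DY: "(Y has_derivative DY) (at y)"
      unfolding Y_def DY_def by (auto intro!: derivative_eq_intros simp: algebra_simps)
    note DS = has_derivative_minus[OF has_derivative_add[OF
        has_derivative_scaleR[OF has_derivative_inner_right[OF DY, of c] has_derivative_ident]
        has_derivative_scaleR[OF has_derivative_inner_right[OF has_derivative_ident, of c] DY]],
        folded S_def]
    note DS' = has_derivative_diff[OF DS
        has_derivative_scaleR[OF has_derivative_inner[OF DS has_derivative_ident] has_derivative_ident]]
    have "Y y = b" "DY a = - (b \<bullet> a) *\<^sub>R y" "S y = - (c \<bullet> b) *\<^sub>R y"
      using ortho by (simp_all add: Y_def DY_def S_def)
    \<comment> \<open>The surviving term comes from differentiating the factor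
      \<open>c \<bullet> z\<close> in \<open>S z\<close>; the two terms along \<open>a\<close>
      cancel.\<close>
    then have "frechet_derivative (\<lambda>z. S z - (S z \<bullet> z) *\<^sub>R z) (at y) a = - (a \<bullet> c) *\<^sub>R b"
      using fun_cong[OF frechet_derivative_at[OF DS'], of a] ortho yy
      by (simp add: inner_diff_left inner_diff_right inner_add_left inner_commute)
    moreover have "sphere_proj y a = a" "sphere_proj y (- (a \<bullet> c) *\<^sub>R b) = - (a \<bullet> c) *\<^sub>R b"
      using ortho by (simp_all add: sphere_proj_def)
    ultimately show ?thesis
      unfolding conn by (simp only: sphere_conn_def)
  qed
  have "lie_bracket (\<lambda>z. sphere_proj z a) (\<lambda>z. sphere_proj z b) y = 0"
    using ortho by (simp add: lie_bracket_def proj) (simp add: sphere_proj_def inner_commute)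
  then have "sphere_conn (lie_bracket (\<lambda>z. sphere_proj z a) (\<lambda>z. sphere_proj z b))
      (\<lambda>z. sphere_proj z c) y = 0"
    by (simp add: sphere_conn_def proj) (simp add: sphere_proj_def)
  then show ?thesis
    unfolding sphere_curvature_def curvature_def using conn2 ortho by simp
qed

section \<open>Immersions into the sphere\<close>

locale sphere_chart =
  fixes U :: "(real ^ 'm::finite) set" and f :: "real ^ 'm \<Rightarrow> 'a::euclidean_space"
  assumes open_U: "open U" and smooth: "smooth_on U f"
    and norm_f: "u \<in> U \<Longrightarrow> norm (f u) = 1"
    and immersion: "u \<in> U \<Longrightarrow> inj (frechet_derivative f (at u))"
begin

abbreviation "G \<equiv> induced_metric f"
abbreviation "D v u \<equiv> dird v f u"

text \<open>The unprojected ambient Hessian. Its tangential part gives the Christoffel symbols, its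
  part along \<open>f\<close> is minus the metric, and the rest is the second fundamental
  form.\<close>

definition hess :: "real ^ 'm \<Rightarrow> real ^ 'm \<Rightarrow> real ^ 'm \<Rightarrow> 'a" where
  "hess v w = dird v (dird w f)"

text \<open>The coordinates of the orthogonal projection of \<open>y\<close> to the tangent space at \<open>u\<close>.\<close>
definition sharp :: "real ^ 'm \<Rightarrow> 'a \<Rightarrow> real ^ 'm" where
  "sharp u y = matrix_inv (G u) *v (\<chi> l. y \<bullet> D (axis l 1) u)"

text \<open>Normality is meant in the ambient space, so the position vector \<open>f u\<close>
  counts as normal.\<close>

definition nml :: "real ^ 'm \<Rightarrow> 'a \<Rightarrow> 'a" where
  "nml u y = y - D (sharp u y) u"

lemma differentiable_f: "u \<in> U \<Longrightarrow> f differentiable (at u)"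
  and differentiable_D: "u \<in> U \<Longrightarrow> dird v f differentiable (at u)"
  and differentiable_hess: "u \<in> U \<Longrightarrow> hess v w differentiable (at u)"
  unfolding hess_def
  using smooth_on_differentiable smooth smooth_on_dird[OF smooth]
    smooth_on_dird[OF smooth_on_dird[OF smooth]] by blast+

lemma linear_D: "u \<in> U \<Longrightarrow> linear (\<lambda>v. D v u)"
  by (rule linear_dird[OF differentiable_f])

lemma D_eq_iff: "u \<in> U \<Longrightarrow> D v u = D w u \<longleftrightarrow> v = w"
  using immersion unfolding dird_def inj_def by blast

lemma hess_commute: "u \<in> U \<Longrightarrow> hess v w u = hess w v u"
  unfolding hess_def by (rule dird_commute[OF open_U _ smooth])

lemma linear_hess_left: "u \<in> U \<Longrightarrow> linear (\<lambda>v. hess v w u)"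
  unfolding hess_def by (rule linear_dird[OF differentiable_D])

lemma linear_hess_right: "u \<in> U \<Longrightarrow> linear (\<lambda>w. hess v w u)"
  using linear_hess_left[of u v] by (simp add: hess_commute[of u v])

lemma metric_prod_induced:
  assumes "u \<in> U"
  shows "metric_prod (G u) v w = D v u \<bullet> D w u"
proof -
  have "D v u \<bullet> D w u =
      (\<Sum>i\<in>UNIV. v $ i *\<^sub>R D (axis i 1) u) \<bullet> (\<Sum>j\<in>UNIV. w $ j *\<^sub>R D (axis j 1) u)"
    using linear_axis_expansion[OF linear_D[OF assms]] by metis
  also have "\<dots> =
      (\<Sum>i\<in>UNIV. \<Sum>j\<in>UNIV. (v $ i *\<^sub>R D (axis i 1) u) \<bullet> (w $ j *\<^sub>R D (axis j 1) u))"
    unfolding inner_sum_left by (intro sum.cong refl inner_sum_right)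
  also have "\<dots> = metric_prod (G u) v w"
    by (simp add: metric_prod_def inner_vec_def matrix_vector_mult_def induced_metric_def
        sum_distrib_left pd_eq_dird mult_ac)
  finally show ?thesis ..
qed

text \<open>A kernel vector of the Gram matrix has a pushforward of length zero, hence vanishes by
  injectivity of the differential.\<close>

lemma det_induced:
  assumes "u \<in> U"
  shows "det (G u) \<noteq> 0"
proof -
  have "v = 0" if "G u *v v = 0" for v
  proof -
    have "D v u \<bullet> D v u = 0"
      using that metric_prod_induced[OF assms, of v v] by (simp add: metric_prod_def)
    then show ?thesis using D_eq_iff[OF assms, of v 0] linear_0[OF linear_D[OF assms]] by simp
  qed
  then show ?thesis
    by (metis invertible_det_nz invertible_left_inverse matrix_left_invertible_ker)
qed

section \<open>Orthogonal projection to the tangent space\<close>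

lemma linear_sharp: "linear (sharp u)"
proof -
  have "linear (\<lambda>y. \<chi> l. y \<bullet> D (axis l 1) u)"
    by (rule linearI) (simp_all add: vec_eq_iff inner_add_left)
  from linear_compose[OF this matrix_vector_mul_linear[of "matrix_inv (G u)"]]
  show ?thesis by (simp add: sharp_def[abs_def] comp_def)
qed

lemma sharp_inner:
  assumes "u \<in> U"
  shows "D (sharp u y) u \<bullet> D t u = y \<bullet> D t u"
proof -
  have "D (sharp u y) u \<bullet> D t u = D t u \<bullet> D (sharp u y) u" by (rule inner_commute)
  also have "\<dots> = t \<bullet> (G u *v sharp u y)"
    by (simp add: metric_prod_induced[OF assms, symmetric] metric_prod_def)
  also have "\<dots> = t \<bullet> (\<chi> l. y \<bullet> D (axis l 1) u)"
    by (simp add: sharp_def matrix_vector_mul_assoc matrix_inv_right[OF det_induced[OF assms]])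
  also have "\<dots> = y \<bullet> (\<Sum>l\<in>UNIV. t $ l *\<^sub>R D (axis l 1) u)"
    by (simp add: inner_vec_def inner_sum_right)
  also have "\<dots> = y \<bullet> D t u" using linear_axis_expansion[OF linear_D[OF assms]] by metis
  finally show ?thesis .
qed

text \<open>Testing with \<open>t = v - w\<close> gives a pushforward of length zero. Tangent
  vectors are identified below through such pairings.\<close>

lemma eq_if_inner_D_eq:
  assumes "u \<in> U" "\<And>t. D v u \<bullet> D t u = D w u \<bullet> D t u"
  shows "v = w"
proof -
  have "(D v u - D w u) \<bullet> (D v u - D w u) = (D v u - D w u) \<bullet> D (v - w) u"
    by (simp add: linear_diff[OF linear_D[OF assms(1)]])
  also have "\<dots> = 0" using assms(2)[of "v - w"] by (simp add: inner_diff_left)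
  finally show ?thesis using D_eq_iff[OF assms(1)] by simp
qed

lemma sharp_D: "u \<in> U \<Longrightarrow> sharp u (D v u) = v"
  by (rule eq_if_inner_D_eq[of u]) (simp_all add: sharp_inner)

lemma linear_nml: "u \<in> U \<Longrightarrow> linear (nml u)"
  unfolding nml_def[abs_def]
  by (intro linear_compose_sub linear_ident linear_compose[OF linear_sharp linear_D, unfolded comp_def])

lemma nml_inner_D: "u \<in> U \<Longrightarrow> nml u y \<bullet> D t u = 0"
  by (simp add: nml_def inner_diff_left sharp_inner)

lemma nml_D: "u \<in> U \<Longrightarrow> nml u (D v u) = 0"
  by (simp add: nml_def sharp_D)

lemma sharp_normal:
  assumes "u \<in> U" "\<And>t. y \<bullet> D t u = 0"
  shows "sharp u y = 0"
  by (rule eq_if_inner_D_eq[OF assms(1)])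
    (simp add: sharp_inner assms linear_0[OF linear_D])

lemma nml_normal:
  assumes "u \<in> U" "\<And>t. y \<bullet> D t u = 0"
  shows "nml u y = y"
  using assms by (simp add: nml_def sharp_normal linear_0[OF linear_D])

text \<open>For uniqueness: a candidate \<open>n\<close> is fixed by \<open>nml u\<close>, and
  \<open>y - n\<close> is tangent, so \<open>nml u y = nml u n = n\<close>.\<close>

lemma normal_part_eq:
  assumes "u \<in> U"
  shows "normal_part f u y = nml u y"
  unfolding normal_part_def
proof (rule the_equality)
  show "(\<forall>t\<in>range (frechet_derivative f (at u)). nml u y \<bullet> t = 0) \<and>
      y - nml u y \<in> range (frechet_derivative f (at u))"
    using nml_inner_D[OF assms, of y] by (auto simp: dird_def nml_def)
next
  fix n assume n: "(\<forall>t\<in>range (frechet_derivative f (at u)). n \<bullet> t = 0) \<and>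
      y - n \<in> range (frechet_derivative f (at u))"
  then obtain v where v: "y - n = D v u" by (auto simp: dird_def)
  have "nml u n = n" by (rule nml_normal[OF assms]) (use n in \<open>auto simp: dird_def\<close>)
  moreover have "nml u y - nml u n = 0"
    using nml_D[OF assms, of v] v by (simp add: linear_diff[OF linear_nml[OF assms], symmetric])
  ultimately show "n = nml u y" by simp
qed

lemma differentiable_matrix_inv_induced:
  "u \<in> U \<Longrightarrow> (\<lambda>z. matrix_inv (G z) $ k $ l) differentiable (at u)"
  by (rule differentiable_matrix_inv[OF open_U _ det_induced])
    (auto simp: induced_metric_def pd_eq_dird intro!: differentiable_inner differentiable_D)

text \<open>Differentiability is asked of the pairings rather than of \<open>y\<close>, so that
  \<open>y\<close> may be a derivative of the tension field, as in
  \<open>differentiable_shape\<close>.\<close>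

lemma differentiable_sharp:
  assumes "u \<in> U" "\<And>l. (\<lambda>z. y z \<bullet> D (axis l 1) z) differentiable (at u)"
  shows "(\<lambda>z. sharp z (y z)) differentiable (at u)"
proof (rule differentiable_vec_lambda)
  fix i
  show "(\<lambda>z. sharp z (y z) $ i) differentiable (at u)"
    unfolding sharp_def matrix_vector_mult_def using assms
    by (auto intro!: differentiable_sum differentiable_mult differentiable_matrix_inv_induced)
qed

text \<open>The product rule on the coordinate expansion of \<open>D (Z z) z\<close>; the Hessian
  arises from differentiating the coordinate vectors.\<close>

lemma dird_pushforward:
  assumes "u \<in> U" "Z differentiable (at u)"
  shows "(\<lambda>z. D (Z z) z) differentiable (at u)"
    and "dird v (\<lambda>z. D (Z z) z) u = D (dird v Z u) u + hess v (Z u) u"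
proof -
  let ?P = "\<lambda>z. \<Sum>i\<in>UNIV. Z z $ i *\<^sub>R D (axis i 1) z"
  have eq: "D (Z z) z = ?P z" if "z \<in> U" for z
    by (rule linear_axis_expansion[OF linear_D[OF that]])
  have P: "(?P has_derivative (\<lambda>v. \<Sum>i\<in>UNIV. Z u $ i *\<^sub>R hess v (axis i 1) u +
      dird v Z u $ i *\<^sub>R D (axis i 1) u)) (at u)"
    unfolding hess_def
    by (intro has_derivative_sum has_derivative_scaleR dird_has_derivative differentiable_D assms
        bounded_linear.has_derivative[OF bounded_linear_vec_nth])
  show "(\<lambda>z. D (Z z) z) differentiable (at u)"
    using differentiable_cong_open[OF open_U assms(1) eq differentiableI[OF P]] .
  have "dird v (\<lambda>z. D (Z z) z) u = dird v ?P u" by (rule dird_cong[OF open_U assms(1) eq])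
  also have "\<dots> = (\<Sum>i\<in>UNIV. Z u $ i *\<^sub>R hess v (axis i 1) u) +
      (\<Sum>i\<in>UNIV. dird v Z u $ i *\<^sub>R D (axis i 1) u)"
    by (simp add: dird_eq[OF P] sum.distrib)
  also have "(\<Sum>i\<in>UNIV. Z u $ i *\<^sub>R hess v (axis i 1) u) = hess v (Z u) u"
    by (rule linear_axis_expansion[OF linear_hess_right[OF assms(1)], symmetric])
  also have "(\<Sum>i\<in>UNIV. dird v Z u $ i *\<^sub>R D (axis i 1) u) = D (dird v Z u) u"
    by (rule linear_axis_expansion[OF linear_D[OF assms(1)], symmetric])
  finally show "dird v (\<lambda>z. D (Z z) z) u = D (dird v Z u) u + hess v (Z u) u" by simp
qed

lemma f_inner_D: "u \<in> U \<Longrightarrow> f u \<bullet> D v u = 0"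
proof -
  assume u: "u \<in> U"
  have "dird v (\<lambda>y. f y \<bullet> f y) u = dird v (\<lambda>_. 1) u"
    by (rule dird_cong[OF open_U u]) (simp add: dot_square_norm norm_f)
  then show ?thesis
    by (simp add: dird_inner differentiable_f u inner_commute)
qed

lemma f_inner_f: "u \<in> U \<Longrightarrow> f u \<bullet> f u = 1"
  by (simp add: dot_square_norm norm_f)

text \<open>Differentiating the orthogonality \<open>f_inner_D\<close> once more.\<close>

lemma f_inner_hess: "u \<in> U \<Longrightarrow> f u \<bullet> hess v w u = - (D v u \<bullet> D w u)"
proof -
  assume u: "u \<in> U"
  have "dird v (\<lambda>y. f y \<bullet> dird w f y) u = dird v (\<lambda>_. 0) u"
    by (rule dird_cong[OF open_U u]) (simp add: f_inner_D)
  then show ?thesis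
    by (simp add: dird_inner differentiable_f differentiable_D u hess_def)
qed

section \<open>The Levi-Civita connection of the induced metric\<close>

text \<open>The three metric derivatives give six Hessian terms; by symmetry of the Hessian four
  cancel and two coincide.\<close>

lemma christoffel_eq:
  assumes "u \<in> U"
  shows "christoffel G k i j u = sharp u (hess (axis i 1) (axis j 1) u) $ k"
proof -
  have "pd i (\<lambda>w. G w $ j $ l) u = hess (axis i 1) (axis j 1) u \<bullet> D (axis l 1) u +
      D (axis j 1) u \<bullet> hess (axis i 1) (axis l 1) u" for i j l
    by (simp add: induced_metric_def pd_eq_dird dird_inner differentiable_D assms hess_def)
  then have "pd i (\<lambda>w. G w $ j $ l) u + pd j (\<lambda>w. G w $ i $ l) u - pd l (\<lambda>w. G w $ i $ j) u =
      2 * (hess (axis i 1) (axis j 1) u \<bullet> D (axis l 1) u)" for l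
    using hess_commute[OF assms] by (simp add: inner_commute)
  then show ?thesis
    by (simp add: christoffel_def sharp_def matrix_vector_mult_def sum_distrib_left mult_ac)
qed

lemma levi_civita_eq:
  assumes "u \<in> U"
  shows "levi_civita G X Y u = dird (X u) Y u + sharp u (hess (X u) (Y u) u)"
proof -
  have "sharp u (hess (X u) (Y u) u) =
      (\<Sum>i\<in>UNIV. \<Sum>j\<in>UNIV. (X u $ i * Y u $ j) *\<^sub>R sharp u (hess (axis i 1) (axis j 1) u))"
    using linear_compose[OF linear_hess_right linear_sharp]
      linear_compose[OF linear_hess_left linear_sharp] assms
    by (intro bilinear_axis_expansion) (auto simp: comp_def)
  then show ?thesis
    by (simp add: levi_civita_def vec_eq_iff christoffel_eq[OF assms] dird_def mult_ac)
qed

text \<open>The Christoffel term pushes forward to the tangential part of the Hessian term in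
  \<open>dird_pushforward\<close>, so both pair equally with tangent vectors.\<close>

lemma D_levi_civita_inner:
  assumes "u \<in> U" "Y differentiable (at u)"
  shows "D (levi_civita G X Y u) u \<bullet> D t u = dird (X u) (\<lambda>z. D (Y z) z) u \<bullet> D t u"
  using assms
  by (simp add: levi_civita_eq dird_pushforward linear_add[OF linear_D] inner_add_left sharp_inner)


text \<open>
  The second fundamental form in the sphere: its correction term cancels the component of the
  Hessian along the position vector, which is minus the induced metric.
\<close>
definition II :: "real ^ 'm \<Rightarrow> real ^ 'm \<Rightarrow> real ^ 'm \<Rightarrow> 'a" where
  "II v w u = nml u (hess v w u) + (D v u \<bullet> D w u) *\<^sub>R f u"

lemma nml_f: "u \<in> U \<Longrightarrow> nml u (f u) = f u"
  by (rule nml_normal) (auto simp: f_inner_D)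

lemma nml_sphere_proj:
  "u \<in> U \<Longrightarrow> nml u (sphere_proj (f u) y) = nml u y - (y \<bullet> f u) *\<^sub>R f u"
  by (simp add: sphere_proj_def linear_diff[OF linear_nml] linear_scale[OF linear_nml] nml_f)

lemma II_eq: "u \<in> U \<Longrightarrow> II v w u = nml u (sphere_proj (f u) (hess v w u))"
  by (simp add: II_def nml_sphere_proj inner_commute[of _ "f u"] f_inner_hess)

lemma linear_II_left: "u \<in> U \<Longrightarrow> linear (\<lambda>v. II v w u)"
  unfolding II_def
  by (rule linearI) (simp_all add: linear_add[OF linear_hess_left] linear_add[OF linear_nml]
      linear_add[OF linear_D] linear_scale[OF linear_hess_left] linear_scale[OF linear_nml]
      linear_scale[OF linear_D] inner_add_left algebra_simps)

lemma II_commute: "u \<in> U \<Longrightarrow> II v w u = II w v u"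
  by (simp add: II_def hess_commute[of u v w] inner_commute)

lemma linear_II_right: "u \<in> U \<Longrightarrow> linear (\<lambda>w. II v w u)"
  using linear_II_left[of u v] by (simp add: II_commute[of u v])

lemma II_inner_D: "u \<in> U \<Longrightarrow> II v w u \<bullet> D t u = 0"
  by (simp add: II_def inner_add_left nml_inner_D f_inner_D)

lemma II_inner_f: "u \<in> U \<Longrightarrow> II v w u \<bullet> f u = 0"
  by (subst inner_commute)
    (simp add: II_def nml_def inner_add_right inner_diff_right f_inner_f f_inner_D f_inner_hess)

text \<open>The normal Hessian is \<open>II\<close> minus a multiple of the unit vector
  \<open>f u\<close>, which is orthogonal to \<open>II\<close>. The product of metrics becomes the
  curvature of the sphere in the Gauss equation.\<close>

lemma nml_hess_inner:
  assumes "u \<in> U"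
  shows "nml u (hess a b u) \<bullet> nml u (hess c d u) =
    II a b u \<bullet> II c d u + (D a u \<bullet> D b u) * (D c u \<bullet> D d u)"
proof -
  have "nml u (hess v w u) = II v w u - (D v u \<bullet> D w u) *\<^sub>R f u" for v w
    by (simp add: II_def)
  moreover have "f u \<bullet> II c d u = 0" by (simp add: inner_commute[of "f u"] II_inner_f assms)
  ultimately show ?thesis
    by (simp add: inner_diff_left inner_diff_right II_inner_f f_inner_f assms)
qed

lemma second_ff_coord_eq:
  "u \<in> U \<Longrightarrow> second_ff_coord f u i j = II (axis i 1) (axis j 1) u"
  by (simp add: second_ff_coord_def normal_part_eq II_eq cov_def pd_eq_dird hess_def)

lemma second_ff_eq: "u \<in> U \<Longrightarrow> second_ff f u v w = II v w u"
  unfolding second_ff_def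
  by (simp add: second_ff_coord_eq
      bilinear_axis_expansion[of "\<lambda>v w. II v w u", OF linear_II_left linear_II_right])

lemma nml_inner_nml: "u \<in> U \<Longrightarrow> nml u y \<bullet> z = nml u y \<bullet> nml u z"
  by (simp add: nml_def[of u z] inner_diff_right nml_inner_D)

text \<open>The Weingarten formula, from differentiating the identity that \<open>\<xi>\<close> is
  orthogonal to \<open>D t\<close>.\<close>

lemma normal_field_derivative:
  assumes "u \<in> U" "\<xi> differentiable (at u)" "\<And>z. z \<in> U \<Longrightarrow> \<xi> z \<bullet> D t z = 0"
  shows "dird v \<xi> u \<bullet> D t u = - (\<xi> u \<bullet> hess v t u)"
proof -
  have "dird v (\<lambda>z. \<xi> z \<bullet> D t z) u = dird v (\<lambda>_. 0) u"
    by (rule dird_cong[OF open_U]) (use assms in auto)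
  then show ?thesis using assms by (simp add: dird_inner differentiable_D hess_def)
qed

section \<open>The Gauss equation\<close>

lemma differentiable_sharp_hess: "u \<in> U \<Longrightarrow> (\<lambda>z. sharp z (hess v w z)) differentiable (at u)"
  by (intro differentiable_sharp differentiable_inner differentiable_hess differentiable_D)

lemma differentiable_nml_hess: "u \<in> U \<Longrightarrow> (\<lambda>z. nml z (hess v w z)) differentiable (at u)"
  unfolding nml_def
  by (intro differentiable_diff differentiable_hess dird_pushforward(1) differentiable_sharp_hess)

text \<open>
  Pushed forward to the ambient space, a covariant derivative is a directional derivative up to
  normal vectors, so no derivatives of Christoffel symbols need to be computed for the curvature.
\<close>
lemma iterated_levi_civita:
  assumes u: "u \<in> U"
  shows "D (levi_civita G (\<lambda>_. v) (levi_civita G (\<lambda>_. a) (\<lambda>_. b)) u) u \<bullet> D t u =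
    dird v (hess a b) u \<bullet> D t u + nml u (hess a b u) \<bullet> nml u (hess v t u)"
proof -
  let ?N = "\<lambda>z. nml z (hess a b z)"
  have eq: "levi_civita G (\<lambda>_. a) (\<lambda>_. b) z = sharp z (hess a b z)" if "z \<in> U" for z
    using that by (simp add: levi_civita_eq)
  have diff: "levi_civita G (\<lambda>_. a) (\<lambda>_. b) differentiable (at u)"
    using differentiable_cong_open[OF open_U u eq differentiable_sharp_hess[OF u]] .
  \<comment> \<open>The tangential part is written as the Hessian minus its normal part, whose
    derivative is governed by \<open>normal_field_derivative\<close>.\<close>
  have "dird v (\<lambda>z. D (levi_civita G (\<lambda>_. a) (\<lambda>_. b) z) z) u = dird v (\<lambda>z. hess a b z - ?N z) u"
    by (rule dird_cong[OF open_U u]) (simp add: eq nml_def)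
  then show ?thesis
    using normal_field_derivative[OF u differentiable_nml_hess[OF u] nml_inner_D]
    by (simp add: D_levi_civita_inner[OF u diff] dird_diff differentiable_nml_hess
        differentiable_hess u inner_diff_left nml_inner_D nml_inner_nml[OF u, of _ "hess v t u"])
qed

text \<open>Constant fields commute, and the third derivatives of \<open>f\<close> cancel by
  \<open>dird_commute\<close>. Only the products of normal Hessians from
  \<open>iterated_levi_civita\<close> remain.\<close>

lemma gauss_equation:
  assumes u: "u \<in> U"
  shows "metric_prod (G u) (curvature (levi_civita G) (\<lambda>_. v) (\<lambda>_. w) (\<lambda>_. w) u) v =
    II v v u \<bullet> II w w u - II v w u \<bullet> II v w u +
    (D v u \<bullet> D v u) * (D w u \<bullet> D w u) - (D v u \<bullet> D w u)\<^sup>2"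
proof -
  have "lie_bracket (\<lambda>_. v) (\<lambda>_. w) = (\<lambda>_. 0)" by (simp add: lie_bracket_def fun_eq_iff)
  then have "levi_civita G (lie_bracket (\<lambda>_. v) (\<lambda>_. w)) (\<lambda>_. w) u = 0"
    using u by (simp add: levi_civita_eq linear_0[OF linear_hess_left] linear_0[OF linear_sharp])
  then have "metric_prod (G u) (curvature (levi_civita G) (\<lambda>_. v) (\<lambda>_. w) (\<lambda>_. w) u) v =
      (dird v (hess w w) u - dird w (hess v w) u) \<bullet> D v u +
      nml u (hess w w u) \<bullet> nml u (hess v v u) - nml u (hess v w u) \<bullet> nml u (hess w v u)"
    by (simp add: metric_prod_induced u curvature_def linear_diff[OF linear_D]
        inner_diff_left iterated_levi_civita)
  moreover have "dird v (hess w w) u = dird w (hess v w) u"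
    unfolding hess_def by (rule dird_commute[OF open_U u smooth_on_dird[OF smooth]])
  ultimately show ?thesis
    by (simp add: nml_hess_inner[OF u] II_commute[OF u, of w v] power2_eq_square
        inner_commute[of "D w u" "D v u"] inner_commute[of "II w w u" "II v v u"])
qed

section \<open>The tension field and the Weingarten operator\<close>

text \<open>The Christoffel correction removes the tangential part of the Hessian and the sphere
  projection its radial part. Hence the tension field is normal and equals \<open>m\<close> times
  the mean curvature.\<close>

lemma nabla_df_eq:
  assumes "u \<in> U"
  shows "nabla_df G f u i j = II (axis i 1) (axis j 1) u"
proof -
  have "(\<Sum>k\<in>UNIV. christoffel G k i j u *\<^sub>R pd k f u) = D (sharp u (hess (axis i 1) (axis j 1) u)) u"
    using linear_axis_expansion[OF linear_D[OF assms], of "sharp u (hess (axis i 1) (axis j 1) u)"]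
    by (simp add: christoffel_eq[OF assms] pd_eq_dird)
  then show ?thesis
    using assms by (simp add: nabla_df_def cov_def pd_eq_dird hess_def[symmetric] II_def nml_def
        sphere_proj_def inner_commute[of _ "f u"] f_inner_hess)
qed

lemma tension_eq:
  "u \<in> U \<Longrightarrow> tension G f u = metric_trace (G u) (\<lambda>i j. II (axis i 1) (axis j 1) u)"
  by (simp add: tension_def metric_trace_def nabla_df_eq)

lemma mean_curvature_eq: "u \<in> U \<Longrightarrow> mean_curvature f u = (1 / real CARD('m)) *\<^sub>R tension G f u"
  by (simp add: tension_eq mean_curvature_def metric_trace_def second_ff_coord_eq)

lemma tension_inner_D: "u \<in> U \<Longrightarrow> tension G f u \<bullet> D t u = 0"
  by (simp add: tension_eq metric_trace_def inner_sum_left II_inner_D)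

lemma tension_inner_f: "u \<in> U \<Longrightarrow> tension G f u \<bullet> f u = 0"
  by (simp add: tension_eq metric_trace_def inner_sum_left II_inner_f)

lemma differentiable_tension:
  assumes "u \<in> U"
  shows "tension G f differentiable (at u)"
proof (rule differentiable_cong_open[OF open_U assms])
  show "tension G f z = (\<Sum>i\<in>UNIV. \<Sum>j\<in>UNIV. matrix_inv (G z) $ i $ j *\<^sub>R II (axis i 1) (axis j 1) z)"
    if "z \<in> U" for z
    using that by (simp add: tension_eq metric_trace_def)
  show "(\<lambda>z. \<Sum>i\<in>UNIV. \<Sum>j\<in>UNIV. matrix_inv (G z) $ i $ j *\<^sub>R II (axis i 1) (axis j 1) z)
      differentiable (at u)"
    unfolding II_def using assms
    by (intro differentiable_sum differentiable_scaleR ballI differentiable_matrix_inv_induced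
        differentiable_add differentiable_nml_hess differentiable_inner differentiable_D
        differentiable_f) simp_all
qed

text \<open>Raising an index with the inverse metric shows existence of the vector described by
  \<open>THE\<close>; \<open>eq_if_inner_D_eq\<close> shows uniqueness.\<close>

lemma weingarten_inner:
  assumes u: "u \<in> U"
  shows "D (weingarten f u \<xi> v) u \<bullet> D t u = II v t u \<bullet> \<xi>"
proof -
  define w where "w = matrix_inv (G u) *v (\<chi> l. II v (axis l 1) u \<bullet> \<xi>)"
  have "metric_prod (G u) w t = II v t u \<bullet> \<xi>" for t
  proof -
    have "metric_prod (G u) w t = metric_prod (G u) t w"
      by (simp add: metric_prod_induced[OF u] inner_commute)
    also have "\<dots> = t \<bullet> (\<chi> l. II v (axis l 1) u \<bullet> \<xi>)"
      by (simp add: metric_prod_def w_def matrix_vector_mul_assoc matrix_inv_right[OF det_induced[OF u]])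
    also have "\<dots> = (\<Sum>l\<in>UNIV. t $ l *\<^sub>R II v (axis l 1) u) \<bullet> \<xi>"
      by (simp add: inner_vec_def inner_sum_left)
    also have "\<dots> = II v t u \<bullet> \<xi>" using linear_axis_expansion[OF linear_II_right[OF u]] by metis
    finally show ?thesis .
  qed
  then have "\<forall>t. metric_prod (G u) w t = second_ff f u v t \<bullet> \<xi>" by (simp add: second_ff_eq[OF u])
  moreover from this have "w' = w" if "\<forall>t. metric_prod (G u) w' t = second_ff f u v t \<bullet> \<xi>" for w'
    using that by (intro eq_if_inner_D_eq[OF u]) (simp add: metric_prod_induced[OF u])
  ultimately have "\<forall>t. metric_prod (G u) (weingarten f u \<xi> v) t = second_ff f u v t \<bullet> \<xi>"
    unfolding weingarten_def by (rule theI)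
  then show ?thesis by (simp add: metric_prod_induced[OF u] second_ff_eq[OF u])
qed

end

section \<open>Biharmonic immersions with parallel mean curvature\<close>

locale parallel_biharmonic_chart = sphere_chart U f
  for U :: "(real ^ 'm::finite) set" and f :: "real ^ 'm \<Rightarrow> 'a::euclidean_space" +
  assumes parallel: "u \<in> U \<Longrightarrow> normal_conn f i (mean_curvature f) u = 0"
    and biharmonic: "u \<in> U \<Longrightarrow> bitension (induced_metric f) f u = 0"
begin

abbreviation "\<tau> \<equiv> tension G f"

text \<open>This is minus the Weingarten operator of the tension field.\<close>
definition shape :: "real ^ 'm \<Rightarrow> real ^ 'm \<Rightarrow> real ^ 'm" where
  "shape v u = sharp u (dird v \<tau> u)"

lemma linear_shape: "u \<in> U \<Longrightarrow> linear (\<lambda>v. shape v u)"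
  unfolding shape_def
  using linear_compose[OF linear_dird[OF differentiable_tension] linear_sharp] by (simp add: comp_def)

lemma dird_tension_inner: "u \<in> U \<Longrightarrow> dird v \<tau> u \<bullet> D t u = - (\<tau> u \<bullet> hess v t u)"
  by (rule normal_field_derivative) (auto simp: differentiable_tension tension_inner_D)

lemma differentiable_shape:
  assumes "u \<in> U"
  shows "shape v differentiable (at u)"
  unfolding shape_def
proof (rule differentiable_sharp[OF assms])
  show "(\<lambda>z. dird v \<tau> z \<bullet> D (axis l 1) z) differentiable (at u)" for l
    \<comment> \<open>The pairing equals \<open>- (\<tau> z \<bullet> hess v (axis l 1) z)\<close>
      on \<open>U\<close>, which involves no derivative of \<open>\<tau>\<close>.\<close>
    by (rule differentiable_cong_open[OF open_U assms dird_tension_inner])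
      (use assms in \<open>auto intro!: differentiable_minus differentiable_inner differentiable_tension
          differentiable_hess\<close>)
qed

text \<open>Parallelism of the mean curvature enters here: \<open>\<tau>\<close> is a constant
  multiple of it, so its covariant derivative has no normal part.\<close>

lemma cov_tension:
  assumes u: "u \<in> U"
  shows "cov f i \<tau> u = D (shape (axis i 1) u) u"
proof -
  have "dird (axis i 1) (mean_curvature f) u = (1 / real CARD('m)) *\<^sub>R dird (axis i 1) \<tau> u"
  proof -
    have "dird (axis i 1) (mean_curvature f) u =
        dird (axis i 1) (\<lambda>z. (1 / real CARD('m)) *\<^sub>R \<tau> z) u"
      by (rule dird_cong[OF open_U u mean_curvature_eq])
    also have "\<dots> = (1 / real CARD('m)) *\<^sub>R dird (axis i 1) \<tau> u"
      by (rule dird_eq[OF has_derivative_scaleR_right[OF dird_has_derivative[OF differentiable_tension[OF u]]]])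
    finally show ?thesis .
  qed
  then have "cov f i (mean_curvature f) u = (1 / real CARD('m)) *\<^sub>R cov f i \<tau> u"
    by (simp add: cov_def pd_eq_dird sphere_proj_def algebra_simps)
  then have "nml u (cov f i \<tau> u) = 0"
    using parallel[OF u, of i] by (simp add: normal_conn_def normal_part_eq u linear_scale[OF linear_nml])
  then have "cov f i \<tau> u = D (sharp u (cov f i \<tau> u)) u" by (simp add: nml_def)
  moreover have "sharp u (cov f i \<tau> u) = shape (axis i 1) u"
    by (simp add: cov_def sphere_proj_def pd_eq_dird shape_def linear_diff[OF linear_sharp]
        linear_scale[OF linear_sharp] sharp_normal[OF u f_inner_D[OF u]])
  ultimately show ?thesis by simp
qed

text \<open>By \<open>cov_tension\<close> the first derivatives are tangent. The Christoffel
  correction thus has no normal part, and differentiating the pushforward leaves only its Hessian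
  term.\<close>

lemma nml_nabla2_tension:
  assumes u: "u \<in> U"
  shows "nml u (nabla2 G f \<tau> u i j) = II (axis i 1) (shape (axis j 1) u) u"
proof -
  have "dird (axis i 1) (cov f j \<tau>) u = dird (axis i 1) (\<lambda>z. D (shape (axis j 1) z) z) u"
    by (rule dird_cong[OF open_U u cov_tension])
  also have "\<dots> = D (dird (axis i 1) (shape (axis j 1)) u) u + hess (axis i 1) (shape (axis j 1) u) u"
    by (rule dird_pushforward(2)[OF u differentiable_shape[OF u]])
  finally have "nml u (cov f i (cov f j \<tau>) u) = II (axis i 1) (shape (axis j 1) u) u"
    using u by (simp add: cov_def pd_eq_dird nml_sphere_proj linear_add[OF linear_nml] nml_D
        inner_add_right inner_commute[of _ "f u"] f_inner_D f_inner_hess II_def)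
  moreover have "nml u (\<Sum>k\<in>UNIV. christoffel G k i j u *\<^sub>R cov f k \<tau> u) = 0"
    using u by (simp add: linear_sum[OF linear_nml] linear_scale[OF linear_nml] cov_tension nml_D)
  ultimately show ?thesis by (simp add: nabla2_def linear_diff[OF linear_nml[OF u]])
qed

lemma nml_metric_trace:
  "u \<in> U \<Longrightarrow> nml u (metric_trace A T) = metric_trace A (\<lambda>i j. nml u (T i j))"
  by (simp add: metric_trace_def linear_sum[OF linear_nml] linear_scale[OF linear_nml])

lemma trace_II_orthonormal:
  "u \<in> U \<Longrightarrow> orthonormal_basis (G u) e \<Longrightarrow> (\<Sum>k\<in>UNIV. II (e k) (e k) u) = \<tau> u"
  by (simp add: tension_eq metric_trace_orthonormal[of _ _ "\<lambda>v w. II v w u", OF _ linear_II_left linear_II_right])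

text \<open>Since \<open>\<tau>\<close> is normal, \<open>sphere_curvature_eq\<close> leaves minus
  the metric times \<open>\<tau>\<close>, with trace \<open>-m\<close> times \<open>\<tau>\<close>.
  The normal part of the bitension equation then follows from
  \<open>nml_nabla2_tension\<close>.\<close>

lemma normal_bitension:
  assumes u: "u \<in> U" and e: "orthonormal_basis (G u) e"
  shows "(\<Sum>k\<in>UNIV. II (e k) (shape (e k) u) u) = - real CARD('m) *\<^sub>R \<tau> u"
proof -
  have "sphere_curvature (f u) (pd i f u) (\<tau> u) (pd j f u) = - (D (axis i 1) u \<bullet> D (axis j 1) u) *\<^sub>R \<tau> u"
    for i j
    using sphere_curvature_eq[OF norm_f[OF u], of "D (axis i 1) u" "\<tau> u" "D (axis j 1) u"] u
    by (simp add: pd_eq_dird tension_inner_f tension_inner_D inner_commute[of "D _ u" "f u"] f_inner_D)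
  then have "metric_trace (G u) (\<lambda>i j. sphere_curvature (f u) (pd i f u) (\<tau> u) (pd j f u)) =
      metric_trace (G u) (\<lambda>i j. - (D (axis i 1) u \<bullet> D (axis j 1) u) *\<^sub>R \<tau> u)"
    by simp
  also have "\<dots> = (\<Sum>k\<in>UNIV. - (D (e k) u \<bullet> D (e k) u) *\<^sub>R \<tau> u)"
    by (rule metric_trace_orthonormal[OF e, of "\<lambda>v w. - (D v u \<bullet> D w u) *\<^sub>R \<tau> u"]; rule linearI)
      (simp_all add: linear_add[OF linear_D[OF u]] linear_scale[OF linear_D[OF u]] inner_add_left
        inner_add_right algebra_simps)
  also have "\<dots> = - real CARD('m) *\<^sub>R \<tau> u"
    using e by (simp add: orthonormal_basis_def metric_prod_induced[OF u, symmetric] scaleR_minus_left sum_negf sum_constant_scaleR)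
  finally have "metric_trace (G u) (nabla2 G f \<tau> u) + real CARD('m) *\<^sub>R \<tau> u = 0"
    using biharmonic[OF u] by (simp add: bitension_def rough_laplacian_def)
  then have "nml u (metric_trace (G u) (nabla2 G f \<tau> u)) = - real CARD('m) *\<^sub>R nml u (\<tau> u)"
    by (metis add.inverse_unique add.commute linear_neg[OF linear_nml[OF u]] linear_scale[OF linear_nml[OF u]] scaleR_minus_left)
  moreover have "nml u (\<tau> u) = \<tau> u" by (rule nml_normal[OF u tension_inner_D[OF u]])
  moreover have "nml u (metric_trace (G u) (nabla2 G f \<tau> u)) =
      metric_trace (G u) (\<lambda>i j. II (axis i 1) (shape (axis j 1) u) u)"
    by (simp add: nml_metric_trace[OF u] nml_nabla2_tension[OF u])
  moreover have "\<dots> = (\<Sum>k\<in>UNIV. II (e k) (shape (e k) u) u)"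
    using metric_trace_orthonormal[OF e, of "\<lambda>v w. II v (shape w u) u"] linear_II_left[OF u]
      linear_compose[OF linear_shape[OF u] linear_II_right[OF u]]
    by (simp add: comp_def)
  ultimately show ?thesis by simp
qed

text \<open>
  In an eigenframe of the Weingarten operator, the normal part of the biharmonic equation becomes
  \<open>\<Sum>\<^sub>k a\<^sub>k B(e\<^sub>k, e\<^sub>k) = m H\<close>.
\<close>
lemma sum_eigenvalue_II:
  assumes u: "u \<in> U" and e: "orthonormal_basis (G u) e"
    and a: "\<And>k. weingarten f u (mean_curvature f u) (e k) = a k *\<^sub>R e k"
  shows "(\<Sum>k\<in>UNIV. a k *\<^sub>R II (e k) (e k) u) = \<tau> u"
proof -
  \<comment> \<open>The factor \<open>-m\<close> arises because \<open>shape\<close> is minus the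
    Weingarten operator of \<open>\<tau>\<close>, and \<open>\<tau>\<close> is \<open>m\<close>
    times the mean curvature.\<close>
  have "shape (e k) u = - (real CARD('m) * a k) *\<^sub>R e k" for k
  proof (rule eq_if_inner_D_eq[OF u])
    fix t
    have "D (shape (e k) u) u \<bullet> D t u = - (\<tau> u \<bullet> hess (e k) t u)"
      by (simp add: shape_def sharp_inner u dird_tension_inner)
    \<comment> \<open>\<open>\<tau> u\<close> is orthogonal to tangent vectors and to
      \<open>f u\<close>, so only \<open>II\<close> contributes.\<close>
    also have "\<tau> u \<bullet> hess (e k) t u = \<tau> u \<bullet> II (e k) t u"
      using tension_inner_D[OF u] tension_inner_f[OF u]
      by (simp add: II_def nml_def inner_add_right inner_diff_right)
    also have "\<dots> = real CARD('m) * (II (e k) t u \<bullet> mean_curvature f u)"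
      by (simp add: mean_curvature_eq u inner_commute)
    also have "\<dots> = real CARD('m) * (a k * (D (e k) u \<bullet> D t u))"
      using weingarten_inner[OF u, of "mean_curvature f u" "e k" t]
      by (simp add: a linear_scale[OF linear_D[OF u]])
    finally show "D (shape (e k) u) u \<bullet> D t u = D (- (real CARD('m) * a k) *\<^sub>R e k) u \<bullet> D t u"
      by (simp only: linear_scale[OF linear_D[OF u]]) simp
  qed
  then have "(\<Sum>k\<in>UNIV. II (e k) (shape (e k) u) u) =
      - real CARD('m) *\<^sub>R (\<Sum>k\<in>UNIV. a k *\<^sub>R II (e k) (e k) u)"
    by (simp only: linear_scale[OF linear_II_right[OF u]]) (simp add: scaleR_sum_right sum_negf)
  with normal_bitension[OF u e] show ?thesis by simp
qed

end

lemma sphere_submanifold_chart: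
  assumes "sphere_submanifold M \<A> \<phi>" "(U, x) \<in> \<A>"
  shows "sphere_chart U (\<phi> \<circ> x)"
proof
  have U: "open U" "openin M (x ` U)"
    and f: "smooth_on U (\<phi> \<circ> x)" "\<forall>u\<in>U. inj (frechet_derivative (\<phi> \<circ> x) (at u))"
    and sphere: "\<phi> ` topspace M \<subseteq> sphere 0 1"
    using assms unfolding sphere_submanifold_def smooth_manifold_def by fast+
  show "open U" "smooth_on U (\<phi> \<circ> x)" by fact+
  show "inj (frechet_derivative (\<phi> \<circ> x) (at u))" if "u \<in> U" for u using f that by blast
  show "norm ((\<phi> \<circ> x) u) = 1" if "u \<in> U" for u
    using openin_subset[OF U(2)] sphere that by (force simp: image_subset_iff)
qed

lemma parallel_biharmonic_chartI:
  assumes "sphere_submanifold M \<A> \<phi>" "proper_biharmonic \<A> \<phi>"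
    "parallel_mean_curvature \<A> \<phi>" "(U, x) \<in> \<A>"
  shows "parallel_biharmonic_chart U (\<phi> \<circ> x)"
proof (intro parallel_biharmonic_chart.intro parallel_biharmonic_chart_axioms.intro)
  show "sphere_chart U (\<phi> \<circ> x)" by (rule sphere_submanifold_chart[OF assms(1,4)])
  show "normal_conn (\<phi> \<circ> x) i (mean_curvature (\<phi> \<circ> x)) u = 0" if "u \<in> U" for u i
    using bspec[OF assms(3)[unfolded parallel_mean_curvature_def] assms(4)] that by simp
  show "bitension (induced_metric (\<phi> \<circ> x)) (\<phi> \<circ> x) u = 0" if "u \<in> U" for u
    using bspec[OF conjunct1[OF assms(2)[unfolded proper_biharmonic_def], unfolded biharmonic_immersion_def]
        assms(4)] that by simp
qed

theorem proposition3p2: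
  fixes M :: "'p topology"
    and \<A> :: "((real ^ 'm::finite) set \<times> (real ^ 'm \<Rightarrow> 'p)) set"
    and \<phi> :: "'p \<Rightarrow> 'a::euclidean_space"
    and n :: nat
    and p :: 'p
    and U :: "(real ^ 'm) set" and x :: "real ^ 'm \<Rightarrow> 'p" and u :: "real ^ 'm"
    and f :: "real ^ 'm \<Rightarrow> 'a" and m :: real and H :: 'a
    and e :: "'m \<Rightarrow> real ^ 'm" and a :: "'m \<Rightarrow> real"
    and K :: "'m \<Rightarrow> 'm \<Rightarrow> real" and B :: "real ^ 'm \<Rightarrow> real ^ 'm \<Rightarrow> 'a"
  assumes "DIM('a) = n + 1"
    and "sphere_submanifold M \<A> \<phi>"
    and "proper_biharmonic \<A> \<phi>"
    and "parallel_mean_curvature \<A> \<phi>"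
    and "p \<in> topspace M" and "(U, x) \<in> \<A>" and "u \<in> U" and "x u = p"
  defines "f \<equiv> \<phi> \<circ> x"
    and "m \<equiv> real CARD('m)"
    and "H \<equiv> mean_curvature f u"
    and "B \<equiv> second_ff f u"
    and "K \<equiv> frame_curvature (induced_metric f) u e"
  assumes "orthonormal_basis (induced_metric f u) e"
    and "\<And>i. weingarten f u H (e i) = a i *\<^sub>R e i"
  shows "(m * (norm H)\<^sup>2 = (\<Sum>i\<in>UNIV. a i) \<and> (\<Sum>i\<in>UNIV. a i) = (\<Sum>i\<in>UNIV. (a i)\<^sup>2)) \<and>
    ((2 * m - 1) * m * (norm H)\<^sup>2 =
      (1/2) * (\<Sum>i\<in>UNIV. \<Sum>j\<in>UNIV. (a i + a j) * (K i j + (norm (B (e i) (e j)))\<^sup>2))) \<and>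
    ((m - 1 + m * (norm H)\<^sup>2) * m * (norm H)\<^sup>2 =
      (\<Sum>i\<in>UNIV. \<Sum>j\<in>UNIV. a i * a j * (K i j + (norm (B (e i) (e j)))\<^sup>2)))"
proof -
  interpret parallel_biharmonic_chart U f
    unfolding f_def by (rule parallel_biharmonic_chartI[OF assms(2-4,6)])
  note u = \<open>u \<in> U\<close> and e = \<open>orthonormal_basis (induced_metric f u) e\<close> and weingarten = assms(15)
  have m: "m > 0" by (simp add: m_def)
  have \<tau>: "\<tau> u = m *\<^sub>R H" using m by (simp add: H_def mean_curvature_eq[OF u] m_def)
  have B: "B (e i) (e j) = II (e i) (e j) u" for i j by (simp add: B_def second_ff_eq[OF u])
  have trace: "(\<Sum>i\<in>UNIV. B (e i) (e i)) = m *\<^sub>R H"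
    using trace_II_orthonormal[OF u e] by (simp add: B \<tau>)
  have trace_a: "(\<Sum>i\<in>UNIV. a i *\<^sub>R B (e i) (e i)) = m *\<^sub>R H"
    using sum_eigenvalue_II[OF u e, of a] weingarten by (simp add: B \<tau> H_def)
  have De: "D (e i) u \<bullet> D (e j) u = (if i = j then 1 else 0)" for i j
    using e by (simp add: orthonormal_basis_def metric_prod_induced[OF u])
  have eigen: "B (e i) (e i) \<bullet> H = a i" for i
    using weingarten_inner[OF u, of H "e i" "e i"] weingarten
    by (simp add: linear_scale[OF linear_D[OF u]] De B)
  define X where "X i j = K i j + (norm (B (e i) (e j)))\<^sup>2" for i j
  \<comment> \<open>For distinct indices orthonormality makes the denominator of the sectional
    curvature one. On the diagonal both sides are the squared norm of
    \<open>B (e i) (e i)\<close>.\<close>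
  have X: "X i j = (if i = j then 0 else 1) + B (e i) (e i) \<bullet> B (e j) (e j)" for i j
    using gauss_equation[OF u, of "e i" "e j"]
    by (simp add: X_def K_def frame_curvature_def sectional_curvature_def metric_prod_induced[OF u] De B
        power2_norm_eq_inner)
  have sum_a: "(\<Sum>i\<in>UNIV. a i) = m * (norm H)\<^sup>2"
    using arg_cong[OF trace, of "\<lambda>y. y \<bullet> H"] by (simp add: inner_sum_left eigen power2_norm_eq_inner)
  have sum_a2: "(\<Sum>i\<in>UNIV. (a i)\<^sup>2) = m * (norm H)\<^sup>2"
    using arg_cong[OF trace_a, of "\<lambda>y. y \<bullet> H"]
    by (simp add: inner_sum_left eigen dot_square_norm power2_eq_square)
  have off: "(\<Sum>j\<in>UNIV. c j * (if i = j then 0 else 1)) = (\<Sum>j\<in>UNIV. c j) - c i" for c :: "'m \<Rightarrow> real" and i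
  proof -
    have "(\<Sum>j\<in>UNIV. c j * (if i = j then 0 else 1)) = (\<Sum>j\<in>UNIV. c j - (if i = j then c j else 0))"
      by (rule sum.cong) auto
    then show ?thesis by (simp add: sum_subtractf)
  qed
  \<comment> \<open>The trace turns the inner product part of \<open>X\<close> into
    \<open>m *\<^sub>R H\<close>, and pairing it with \<open>B (e i) (e i)\<close> gives
    \<open>m * a i\<close> by \<open>eigen\<close>.\<close>
  have row: "(\<Sum>j\<in>UNIV. X i j) = m - 1 + m * a i" for i
  proof -
    have "(\<Sum>j\<in>UNIV. X i j) =
        (\<Sum>j\<in>UNIV. 1 * (if i = j then 0 else 1)) + B (e i) (e i) \<bullet> (\<Sum>j\<in>UNIV. B (e j) (e j))"
      by (simp add: X sum.distrib inner_sum_right)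
    then show ?thesis unfolding off trace by (simp add: eigen m_def)
  qed
  \<comment> \<open>The weighted trace is again \<open>m *\<^sub>R H\<close>, by biharmonicity, so
    the inner product part is the same as in \<open>row\<close>.\<close>
  have row_a: "(\<Sum>j\<in>UNIV. a j * X i j) = m * (norm H)\<^sup>2 - a i + m * a i" for i
  proof -
    have "(\<Sum>j\<in>UNIV. a j * X i j) =
        (\<Sum>j\<in>UNIV. a j * (if i = j then 0 else 1)) + B (e i) (e i) \<bullet> (\<Sum>j\<in>UNIV. a j *\<^sub>R B (e j) (e j))"
      by (simp only: X distrib_left sum.distrib inner_sum_right inner_scaleR_right)
    then show ?thesis unfolding off trace_a by (simp add: eigen sum_a)
  qed
  have "(\<Sum>i\<in>UNIV. \<Sum>j\<in>UNIV. (a i + a j) * X i j) =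
      (\<Sum>i\<in>UNIV. a i * (m - 1 + m * a i) + (m * (norm H)\<^sup>2 - a i + m * a i))"
    by (simp only: distrib_right sum.distrib sum_distrib_left[symmetric] row row_a)
  also have "\<dots> = (\<Sum>i\<in>UNIV. 2 * (m - 1) * a i + m * (a i)\<^sup>2 + m * (norm H)\<^sup>2)"
    by (rule sum.cong) (simp_all add: algebra_simps power2_eq_square)
  also have "\<dots> = 2 * (m - 1) * (\<Sum>i\<in>UNIV. a i) + m * (\<Sum>i\<in>UNIV. (a i)\<^sup>2) + m * (m * (norm H)\<^sup>2)"
    by (simp add: sum.distrib sum_distrib_left m_def)
  finally have ii: "(\<Sum>i\<in>UNIV. \<Sum>j\<in>UNIV. (a i + a j) * X i j) =
      2 * (m - 1) * (\<Sum>i\<in>UNIV. a i) + m * (\<Sum>i\<in>UNIV. (a i)\<^sup>2) + m * (m * (norm H)\<^sup>2)" .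
  have "(\<Sum>i\<in>UNIV. \<Sum>j\<in>UNIV. a i * a j * X i j) =
      (\<Sum>i\<in>UNIV. a i * (m * (norm H)\<^sup>2 - a i + m * a i))"
    by (simp only: mult.assoc sum_distrib_left[symmetric] row_a)
  also have "\<dots> = (\<Sum>i\<in>UNIV. m * (norm H)\<^sup>2 * a i + (m - 1) * (a i)\<^sup>2)"
    by (rule sum.cong) (simp_all add: algebra_simps power2_eq_square)
  also have "\<dots> = m * (norm H)\<^sup>2 * (\<Sum>i\<in>UNIV. a i) + (m - 1) * (\<Sum>i\<in>UNIV. (a i)\<^sup>2)"
    by (simp add: sum.distrib sum_distrib_left)
  finally have iii: "(\<Sum>i\<in>UNIV. \<Sum>j\<in>UNIV. a i * a j * X i j) =
      m * (norm H)\<^sup>2 * (\<Sum>i\<in>UNIV. a i) + (m - 1) * (\<Sum>i\<in>UNIV. (a i)\<^sup>2)" .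
  \<comment> \<open>Both eigenvalue sums equal s = m|H|^2, so \<open>ii\<close> totals (2(m-1) + m +
    m)s, twice the value in (ii), and \<open>iii\<close> totals (s + m - 1)s.\<close>
  show ?thesis unfolding X_def[symmetric] ii iii sum_a sum_a2 by (simp add: algebra_simps)
qed

end
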